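(* Let $\mathbb{X}$ be a countably infinite alphabet and $\mu$ a probability measure on $\mathbb{X}$ with $\mu(x)>0$ for all $x\in\mathbb{X}$. Let $P\in\mathbb{E}$ with $H(P_1\|\mu)<\infty$. Then $$\lim_{n\to\infty}\frac1n\Big[-\log\mathrm{NPD}_\mu(X_{1:n})-\sum_{i=1}^n\log\mu(X_i)\Big]=h\quad P\text{-a.s.}$$
   Context: On $\mathbb{X}^{\mathbb{Z}}$ (all subsets of $\mathbb{X}$ measurable), $X_k$ are coordinate maps, $x_{j:k}=(x_j,\dots,x_k)$; $P(x_{1:n})$ is the probability of $X_{1:n}=x_{1:n}$ and $P(x)=P(X_1=x)$. $\mathbb{E}$: shift-stationary ergodic probability measures. $h=\lim_n\mathbb{E}[-\log P(X_{1:n})]/n$ (entropy rate w.r.t. counting measure); $H(P_1\|\mu)=-\sum_xP(x)\log\mu(x)$. NPD density: fix finite $\sigma$-fields $\mathcal{X}_0\subset\mathcal{X}_1\subset\cdots$ on $\mathbb{X}$ with $\mathcal{X}_0=\{\emptyset,\mathbb{X}\}$ and $\sigma(\bigcup_l\mathcal{X}_l)=2^{\mathbb{X}}$; let $\chi_l$ be the finite partition generating $\mathcal{X}_l$. For $x\in\mathbb{X}$ let $x^l$ be the cell $A\in\chi_l$ with $x\in A$, $x^l_{1:n}=(x^l_1,\dots,x^l_n)$. Treat $\chi_l$ as a finite alphabet and let $R^l$ be a probability measure on $\chi_l^{\mathbb{Z}}$ universal with respect to the alphabet $\chi_l$ (for every stationary ergodic process $(Y_i)$ over $\chi_l$ with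 Shannon entropy rate $H$, $-\frac1n\log R^l(Y_{1:n})\to H$ a.s., in expectation and in probability). $\mathrm{NPD}^l_\mu(x_{1:n})=R^l(x^l_{1:n})/\prod_{i=1}^n\mu(x_i^l)$, $\mathrm{NPD}_\mu(x_{1:n})=\sum_{l\ge0}w_l\mathrm{NPD}^l_\mu(x_{1:n})$, $w_l=\frac1{l+1}-\frac1{l+2}$. *)

theory Defs
  imports "HOL-Probability.Probability"
begin

definition seqM :: "'b set \<Rightarrow> (int \<Rightarrow> 'b) measure" where
  "seqM S = PiM UNIV (\<lambda>_. count_space S)"

definition shift :: "(int \<Rightarrow> 'b) \<Rightarrow> int \<Rightarrow> 'b" where
  "shift \<omega> = (\<lambda>k. \<omega> (k + 1))"

definition stationary_ergodic :: "'b set \<Rightarrow> (int \<Rightarrow> 'b) measure \<Rightarrow> bool" where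
  "stationary_ergodic S Q \<longleftrightarrow>
     prob_space Q \<and> sets Q = sets (seqM S) \<and>
     distr Q (seqM S) shift = Q \<and>
     (\<forall>A\<in>sets Q. shift -` A \<inter> space Q = A \<longrightarrow> measure Q A = 0 \<or> measure Q A = 1)"

definition block_prob :: "(int \<Rightarrow> 'b) measure \<Rightarrow> nat \<Rightarrow> (int \<Rightarrow> 'b) \<Rightarrow> real" where
  "block_prob Q n \<omega> = measure Q {\<omega>' \<in> space Q. \<forall>i\<in>{1..int n}. \<omega>' i = \<omega> i}"

definition neglog :: "real \<Rightarrow> ereal" where
  "neglog p = (if p > 0 then ereal (- ln p) else \<infinity>)"

definition entropy_rate :: "(int \<Rightarrow> 'b) measure \<Rightarrow> ereal" where
  "entropy_rate Q = lim (\<lambda>n. enn2ereal (\<integral>\<^sup>+ \<omega>. e2ennreal (neglog (block_prob Q n \<omega>)) \<partial>Q)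
                            / ereal (real n))"

definition universal :: "'b set \<Rightarrow> (int \<Rightarrow> 'b) measure \<Rightarrow> bool" where
  "universal S R \<longleftrightarrow>
     (\<forall>Q. stationary_ergodic S Q \<longrightarrow>
        (let Z = (\<lambda>n \<omega>. neglog (measure R {\<eta> \<in> space R. \<forall>i\<in>{1..int n}. \<eta> i = \<omega> i})
                         / ereal (real n))
         in (AE \<omega> in Q. (\<lambda>n. Z n \<omega>) \<longlonglongrightarrow> entropy_rate Q) \<and>
            (\<lambda>n. enn2ereal (\<integral>\<^sup>+ \<omega>. e2ennreal (Z n \<omega>) \<partial>Q)) \<longlonglongrightarrow> entropy_rate Q \<and>
            (\<forall>\<epsilon>>0. (\<lambda>n. measure Q {\<omega> \<in> space Q. \<bar>Z n \<omega> - entropy_rate Q\<bar> > ereal \<epsilon>})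
                      \<longlonglongrightarrow> 0)))"

definition npd_weight :: "nat \<Rightarrow> real" where
  "npd_weight l = 1 / (real l + 1) - 1 / (real l + 2)"

text \<open>NPD^l_mu(x_{1:n}), where x = omega and cell l x is the cell of chi_l containing x.\<close>
definition NPD_l :: "(nat \<Rightarrow> 'a \<Rightarrow> 'a set) \<Rightarrow> (nat \<Rightarrow> (int \<Rightarrow> 'a set) measure) \<Rightarrow> 'a pmf
      \<Rightarrow> nat \<Rightarrow> nat \<Rightarrow> (int \<Rightarrow> 'a) \<Rightarrow> real" where
  "NPD_l cell R \<mu> l n \<omega> =
     measure (R l) {\<eta> \<in> space (R l). \<forall>i\<in>{1..int n}. \<eta> i = cell l (\<omega> i)}
     / (\<Prod>i\<in>{1..int n}. measure_pmf.prob \<mu> (cell l (\<omega> i)))"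

definition NPD :: "(nat \<Rightarrow> 'a \<Rightarrow> 'a set) \<Rightarrow> (nat \<Rightarrow> (int \<Rightarrow> 'a set) measure) \<Rightarrow> 'a pmf
      \<Rightarrow> nat \<Rightarrow> (int \<Rightarrow> 'a) \<Rightarrow> real" where
  "NPD cell R \<mu> n \<omega> = (\<Sum>l. npd_weight l * NPD_l cell R \<mu> l n \<omega>)"

end

theory Submission
  imports Defs
begin

text \<open>
  Gibbs' inequality in the form "a code with total mass at most 1 is on average no shorter than
  the self-information" drives everything.
  Upper bound: a single term of the mixture costs a constant; universality of R^l on the quantized
  process, whose entropy rate is at most h by data processing, and the ergodic theorem for
  ln (mu (x^l) / mu (x)) give the limsup, and the mean of the latter tends to 0 as l grows.
  Lower bound: the NPD density times the product of mu is a sub-probability on words, so by Markov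
  and summability it is at most (n+1)^2 P(X_{1:n}) eventually. It remains to see that
  -ln P(X_{1:n}) / n has liminf at least h, which is proved without martingales: by ergodicity the
  failure of the bound would make blocks of probability more than exp (-m c), c < h, start almost
  everywhere; cutting words greedily into such blocks codes X_{1:n} with fewer than n h nats on
  average, contradicting Gibbs' inequality.
\<close>

text \<open>The lower bound has to hold for the whole mixture, that is for all levels l at once, and
  universality of each R^l separately gives nothing uniform in l; hence it uses only that the
  mixture has total mass at most 1, whatever the R^l are. Finiteness of H(P_1||\<mu>) enters as
  integrability of -ln \<mu>(X_1). By Gibbs' inequality the mean of this function bounds the entropy
  of one letter and so makes all block entropies finite. The same function dominates ln (\<mu>(x^l)
  / \<mu>(x)) at every level, so the mean of this loss vanishes by dominated convergence as the
  cells shrink to points. The greedy code must also pay for describing its block lengths. The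
  lengths carry the weights w_l again: -ln w_l grows like 2 ln l, which is negligible per letter
  once blocks are long. A lower limit on the lengths controls this price, and an upper limit bounds
  the stretch at the end of a word where a block may no longer fit.\<close>

section \<open>Self-information and sums over words\<close>

text \<open>Truncated at 0: the value is 0 for arguments above 1, so that no hypothesis on the size of a code is needed below.\<close>

definition nlog :: "real \<Rightarrow> ennreal" where "nlog p = e2ennreal (neglog p)"

lemma nlog_pos: "x > 0 \<Longrightarrow> nlog x = ennreal (- ln x)"
  by (simp add: nlog_def neglog_def)

lemma nlog_nonpos: "x \<le> 0 \<Longrightarrow> nlog x = \<infinity>"
  by (simp add: nlog_def neglog_def)

lemma nlog_one [simp]: "nlog 1 = 0"
  by (simp add: nlog_pos)

lemma nlog_antimono: "x \<le> y \<Longrightarrow> nlog y \<le> nlog x"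
  by (cases "x > 0") (auto simp: nlog_pos nlog_nonpos not_less intro!: ennreal_leI)

lemma nlog_mult: "x \<ge> 0 \<Longrightarrow> y \<ge> 0 \<Longrightarrow> nlog (x * y) \<le> nlog x + nlog y"
proof -
  assume "x \<ge> 0" "y \<ge> 0"
  have "ennreal (- ln x + - ln y) \<le> ennreal (- ln x) + ennreal (- ln y)" for x y
  proof -
    have "ennreal (- ln x + - ln y) \<le> ennreal (max 0 (- ln x) + max 0 (- ln y))"
      by (intro ennreal_leI) auto
    also have "\<dots> = ennreal (max 0 (- ln x)) + ennreal (max 0 (- ln y))"
      by (intro ennreal_plus) auto
    finally show ?thesis by simp
  qed
  then show ?thesis
    using \<open>x \<ge> 0\<close> \<open>y \<ge> 0\<close>
    by (cases "x = 0"; cases "y = 0") (auto simp: nlog_pos nlog_nonpos ln_mult)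
qed

text \<open>This is ln t \<le> t - 1 at t = q / p, arranged so that nothing is subtracted in
  \<open>ennreal\<close>. Truncation only enlarges \<open>nlog q\<close>, while
  \<open>p \<le> 1\<close> keeps \<open>nlog p\<close> exact.\<close>

lemma nlog_gibbs:
  assumes "0 < p" "p \<le> 1" "0 \<le> q"
  shows "nlog p + 1 \<le> nlog q + ennreal (q / p)"
proof (cases "q = 0")
  case False
  then have q: "q > 0" using assms by simp
  have "ln (q / p) \<le> q / p - 1" using q assms by (intro ln_le_minus_one) auto
  then have "- ln p + 1 \<le> max 0 (- ln q) + q / p" using q assms by (simp add: ln_div)
  then have "ennreal (- ln p) + ennreal 1 \<le> ennreal (max 0 (- ln q)) + ennreal (q / p)"
    using assms by (simp add: ennreal_leI flip: ennreal_plus del: ennreal_1 ennreal_max_0)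
  then show ?thesis using q assms by (simp add: nlog_pos)
qed (simp add: nlog_nonpos)

text \<open>Iterated over letters, not one sum over a set of lists, so that inductions peel off the
  first letter just as \<open>word\<close> does.\<close>

primrec word_sum :: "nat \<Rightarrow> ('b list \<Rightarrow> ennreal) \<Rightarrow> ennreal" where
  "word_sum 0 F = F []"
| "word_sum (Suc n) F = (\<integral>\<^sup>+x. word_sum n (\<lambda>w. F (x # w)) \<partial>count_space UNIV)"

lemma word_sum_mono:
  "(\<And>w. length w = n \<Longrightarrow> F w \<le> G w) \<Longrightarrow> word_sum n F \<le> word_sum n G"
  by (induction n arbitrary: F G) (auto intro!: nn_integral_mono)

text \<open>Tonelli, one letter at a time; the claims are proved jointly because the step integrates
  the inner sum. With a counting measure for \<open>M\<close> it also exchanges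
  \<open>word_sum\<close> with finite sums and series.\<close>

lemma word_sum_nn_integral:
  fixes F :: "'b::countable list \<Rightarrow> 'c \<Rightarrow> ennreal"
  assumes "\<And>w. F w \<in> borel_measurable M"
  shows "word_sum n (\<lambda>w. \<integral>\<^sup>+\<eta>. F w \<eta> \<partial>M) = (\<integral>\<^sup>+\<eta>. word_sum n (\<lambda>w. F w \<eta>) \<partial>M)"
    and "(\<lambda>\<eta>. word_sum n (\<lambda>w. F w \<eta>)) \<in> borel_measurable M"
proof -
  have "(word_sum n (\<lambda>w. \<integral>\<^sup>+\<eta>. F w \<eta> \<partial>M) = (\<integral>\<^sup>+\<eta>. word_sum n (\<lambda>w. F w \<eta>) \<partial>M))
      \<and> (\<lambda>\<eta>. word_sum n (\<lambda>w. F w \<eta>)) \<in> borel_measurable M"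
    using assms
  proof (induction n arbitrary: F)
    case (Suc n)
    have m: "(\<lambda>\<eta>. word_sum n (\<lambda>w. F (x # w) \<eta>)) \<in> borel_measurable M" for x
      using Suc.IH[of "\<lambda>w. F (x # w)"] Suc.prems by auto
    have "sigma_finite_measure (count_space (UNIV :: 'b set))"
      by (rule sigma_finite_measure_count_space)
    then have "(\<lambda>\<eta>. \<integral>\<^sup>+x. word_sum n (\<lambda>w. F (x # w) \<eta>) \<partial>count_space UNIV) \<in> borel_measurable M"
      using m by (intro sigma_finite_measure.borel_measurable_nn_integral) 
         (auto simp: split_beta' intro!: measurable_compose_countable[where g=snd] measurable_compose[OF measurable_fst])
    moreover have "(\<integral>\<^sup>+x. word_sum n (\<lambda>w. \<integral>\<^sup>+\<eta>. F (x # w) \<eta> \<partial>M) \<partial>count_space UNIV)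
       = (\<integral>\<^sup>+\<eta>. \<integral>\<^sup>+x. word_sum n (\<lambda>w. F (x # w) \<eta>) \<partial>count_space UNIV \<partial>M)"
      using Suc.IH[of "\<lambda>w. F (x # w)" for x] Suc.prems m
      by (subst nn_integral_count_space_nn_integral) auto
    ultimately show ?case by simp
  qed simp
  then show "word_sum n (\<lambda>w. \<integral>\<^sup>+\<eta>. F w \<eta> \<partial>M) = (\<integral>\<^sup>+\<eta>. word_sum n (\<lambda>w. F w \<eta>) \<partial>M)"
    and "(\<lambda>\<eta>. word_sum n (\<lambda>w. F w \<eta>)) \<in> borel_measurable M"
    by auto
qed

lemma word_sum_sum:
  fixes F :: "'i \<Rightarrow> 'b::countable list \<Rightarrow> ennreal"
  assumes "finite I"
  shows "word_sum n (\<lambda>w. \<Sum>i\<in>I. F i w) = (\<Sum>i\<in>I. word_sum n (F i))"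
  using word_sum_nn_integral(1)[of "\<lambda>w i. F i w" "count_space I" n] assms
  by (simp add: nn_integral_count_space_finite)

lemma word_sum_suminf:
  fixes F :: "nat \<Rightarrow> 'b::countable list \<Rightarrow> ennreal"
  shows "word_sum n (\<lambda>w. \<Sum>i. F i w) = (\<Sum>i. word_sum n (F i))"
  using word_sum_nn_integral(1)[of "\<lambda>w i. F i w" "count_space UNIV" n]
  by (simp add: nn_integral_count_space_nat)

lemma word_sum_cmult: "word_sum n (\<lambda>w. c * F w) = c * word_sum n F"
  by (induction n arbitrary: F) (auto simp: nn_integral_cmult)

lemma word_sum_append:
  "word_sum (m + n) (\<lambda>w. F (take m w) * G (drop m w)) = word_sum m F * word_sum n G"
proof (induction m arbitrary: F)
  case (Suc m)
  show ?case
    using Suc.IH[of "\<lambda>w. F (x # w)" for x] by (simp add: nn_integral_multc)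
qed (simp add: word_sum_cmult)

lemma word_sum_indicator:
  "length v = n \<Longrightarrow> word_sum n (\<lambda>w. G w * indicator {v} w) = G v"
proof (induction n arbitrary: v G)
  case (Suc n)
  then obtain a u where v: "v = a # u" "length u = n" by (cases v) auto
  have "word_sum n (\<lambda>w. G (x # w) * indicator {v} (x # w))
      = word_sum n (\<lambda>w. (G (x # w) * indicator {a} x) * indicator {u} w)" for x
    by (rule arg_cong[where f="word_sum n"]) (auto simp: v indicator_def)
  also have "\<dots> x = G (x # u) * indicator {a} x" for x
    using Suc.IH[OF v(2), of "\<lambda>w. G (x # w) * indicator {a} x"] by simp
  finally show ?case
    by (simp add: v)
qed simp

section \<open>Stationary sources, block entropies and Gibbs' inequality\<close>

locale stationary_source = prob_space M for M :: "'w measure" +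
  fixes T :: "'w \<Rightarrow> 'w" and X :: "'w \<Rightarrow> 'b::countable"
  assumes T_meas [measurable]: "T \<in> measurable M M"
    and T_inv: "distr M M T = M"
    and X_meas [measurable]: "X \<in> measurable M (count_space UNIV)"
begin

primrec word :: "nat \<Rightarrow> 'w \<Rightarrow> 'b list" where
  "word 0 \<omega> = []"
| "word (Suc n) \<omega> = X \<omega> # word n (T \<omega>)"

lemma length_word [simp]: "length (word n \<omega>) = n"
  by (induction n arbitrary: \<omega>) auto

lemma word_meas [measurable]: "word n \<in> measurable M (count_space UNIV)"
proof (induction n)
  case (Suc n)
  have "(\<lambda>\<omega>. (\<lambda>x \<omega>. x # word n (T \<omega>)) (X \<omega>) \<omega>) \<in> measurable M (count_space UNIV)"
    using measurable_compose[OF measurable_compose[OF T_meas Suc], of "(#) x" "count_space UNIV" for x]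
    by (rule measurable_compose_countable[OF _ X_meas]) auto
  then show ?case by simp
qed (simp add: word_def)

lemma Tn_meas [measurable]: "(T ^^ n) \<in> measurable M M"
  by (induction n) (auto intro: measurable_compose[OF T_meas] simp: comp_def funpow_swap1)

lemma take_word: "take m (word (m + n) \<omega>) = word m \<omega>"
  by (induction m arbitrary: \<omega>) auto

lemma drop_word: "drop m (word (m + n) \<omega>) = word n ((T ^^ m) \<omega>)"
  by (induction m arbitrary: \<omega>) (auto simp del: funpow.simps simp: funpow_Suc_right)

lemma nn_integral_T:
  assumes "f \<in> borel_measurable M"
  shows "(\<integral>\<^sup>+\<omega>. f (T \<omega>) \<partial>M) = (\<integral>\<^sup>+\<omega>. f \<omega> \<partial>M)"
  using nn_integral_distr[OF T_meas, of f] assms by (simp add: T_inv)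

lemma nn_integral_Tn:
  assumes f: "f \<in> borel_measurable M"
  shows "(\<integral>\<^sup>+\<omega>. f ((T ^^ n) \<omega>) \<partial>M) = (\<integral>\<^sup>+\<omega>. f \<omega> \<partial>M)"
proof (induction n)
  case (Suc n)
  have "(\<lambda>\<omega>. f ((T ^^ n) \<omega>)) \<in> borel_measurable M" using f by simp
  from nn_integral_T[OF this] Suc show ?case by (simp del: funpow.simps add: funpow_Suc_right)
qed simp

definition word_prob :: "nat \<Rightarrow> 'b list \<Rightarrow> real" where
  "word_prob n w = prob {\<omega> \<in> space M. word n \<omega> = w}"

lemma word_prob_nonneg [simp]: "0 \<le> word_prob n w"
  and word_prob_le_1 [simp]: "word_prob n w \<le> 1"
  by (auto simp: word_prob_def)

lemma nn_integral_word:
  "(\<integral>\<^sup>+\<omega>. G (word n \<omega>) \<partial>M) = word_sum n (\<lambda>w. G w * ennreal (word_prob n w))"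
proof -
  \<comment> \<open>The indicator of the actual word turns the integrand into a sum over all words,
    ready for Tonelli.\<close>
  have "(\<integral>\<^sup>+\<omega>. G (word n \<omega>) \<partial>M) = (\<integral>\<^sup>+\<omega>. word_sum n (\<lambda>w. G w * indicator {w} (word n \<omega>)) \<partial>M)"
    using word_sum_indicator[of "word n \<omega>" n G for \<omega>]
    by (intro nn_integral_cong) (simp add: indicator_def eq_commute)
  also have "\<dots> = word_sum n (\<lambda>w. \<integral>\<^sup>+\<omega>. G w * indicator {w} (word n \<omega>) \<partial>M)"
    by (intro word_sum_nn_integral(1)[symmetric]) measurable
  also have "(\<lambda>w. \<integral>\<^sup>+\<omega>. G w * indicator {w} (word n \<omega>) \<partial>M) = (\<lambda>w. G w * ennreal (word_prob n w))"
  proof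
    fix w
    have "(\<integral>\<^sup>+\<omega>. indicator {w} (word n \<omega>) \<partial>M) = (\<integral>\<^sup>+\<omega>. indicator {\<omega> \<in> space M. word n \<omega> = w} \<omega> \<partial>M)"
      by (intro nn_integral_cong) (auto simp: indicator_def)
    then show "(\<integral>\<^sup>+\<omega>. G w * indicator {w} (word n \<omega>) \<partial>M) = G w * ennreal (word_prob n w)"
      by (simp add: nn_integral_cmult word_prob_def emeasure_eq_measure)
  qed
  finally show ?thesis .
qed

lemma word_sum_word_prob: "word_sum n (\<lambda>w. ennreal (word_prob n w)) = 1"
  using nn_integral_word[of "\<lambda>_. 1" n] by (simp add: emeasure_space_1)

lemma word_prob_pos: "AE \<omega> in M. word_prob n (word n \<omega>) > 0"
proof -
  have "(\<integral>\<^sup>+\<omega>. indicator {w. word_prob n w = 0} (word n \<omega>) \<partial>M) = 0"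
    using word_sum_mono[of n "\<lambda>w. indicator {w. word_prob n w = 0} w * ennreal (word_prob n w)" "\<lambda>w. 0 * 1"]
    unfolding nn_integral_word word_sum_cmult by (auto simp: indicator_def)
  then have "AE \<omega> in M. indicator {w. word_prob n w = 0} (word n \<omega>) = (0::ennreal)"
    by (subst (asm) nn_integral_0_iff_AE) auto
  then show ?thesis
    by eventually_elim (auto simp: indicator_def order.strict_iff_order split: if_splits)
qed

text \<open>Words of probability 0 drop out of the integral, hence an inequality. It serves both
  \<open>gibbs\<close> and the almost sure comparison in
  \<open>eventually_le_word_prob\<close>.\<close>

lemma nn_integral_ratio_le:
  assumes "\<And>w. 0 \<le> F w"
  shows "(\<integral>\<^sup>+\<omega>. ennreal (F (word n \<omega>) / word_prob n (word n \<omega>)) \<partial>M) \<le> word_sum n (\<lambda>w. ennreal (F w))"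
  unfolding nn_integral_word[of "\<lambda>w. ennreal (F w / word_prob n w)"]
  by (intro word_sum_mono) (auto simp: assms simp flip: ennreal_mult intro!: ennreal_leI)

definition block_entropy :: "nat \<Rightarrow> ennreal" where
  "block_entropy n = (\<integral>\<^sup>+\<omega>. nlog (word_prob n (word n \<omega>)) \<partial>M)"

text \<open>Integrate \<open>nlog_gibbs\<close>. Only the constant 1 is cancelled at the end, so
  either side may be infinite.\<close>

lemma gibbs:
  assumes "\<And>w. 0 \<le> F w" and F: "word_sum n (\<lambda>w. ennreal (F w)) \<le> 1"
  shows "block_entropy n \<le> (\<integral>\<^sup>+\<omega>. nlog (F (word n \<omega>)) \<partial>M)"
proof -
  have "block_entropy n + 1 = (\<integral>\<^sup>+\<omega>. nlog (word_prob n (word n \<omega>)) + 1 \<partial>M)"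
    by (simp add: block_entropy_def nn_integral_add emeasure_space_1)
  also have "\<dots> \<le> (\<integral>\<^sup>+\<omega>. nlog (F (word n \<omega>)) + ennreal (F (word n \<omega>) / word_prob n (word n \<omega>)) \<partial>M)"
    using word_prob_pos[of n]
    by (intro nn_integral_mono_AE, eventually_elim) (auto intro!: nlog_gibbs assms)
  also have "\<dots> = (\<integral>\<^sup>+\<omega>. nlog (F (word n \<omega>)) \<partial>M) + (\<integral>\<^sup>+\<omega>. ennreal (F (word n \<omega>) / word_prob n (word n \<omega>)) \<partial>M)"
    by (intro nn_integral_add) auto
  also have "\<dots> \<le> (\<integral>\<^sup>+\<omega>. nlog (F (word n \<omega>)) \<partial>M) + 1"
    using order_trans[OF nn_integral_ratio_le[of F n] F] assms by (intro add_left_mono) auto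
  finally show ?thesis by simp
qed

text \<open>The competing code is the product of the laws of the two parts of the word.\<close>

lemma block_entropy_add: "block_entropy (m + n) \<le> block_entropy m + block_entropy n"
proof -
  let ?F = "\<lambda>w. word_prob m (take m w) * word_prob n (drop m w)"
  have "block_entropy (m + n) \<le> (\<integral>\<^sup>+\<omega>. nlog (?F (word (m + n) \<omega>)) \<partial>M)"
    using word_sum_append[of m n "\<lambda>w. ennreal (word_prob m w)" "\<lambda>w. ennreal (word_prob n w)"]
    by (intro gibbs) (auto simp: ennreal_mult word_sum_word_prob)
  also have "\<dots> \<le> (\<integral>\<^sup>+\<omega>. nlog (word_prob m (word m \<omega>)) + nlog (word_prob n (word n ((T ^^ m) \<omega>))) \<partial>M)"
    by (intro nn_integral_mono) (auto simp: take_word drop_word intro!: nlog_mult)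
  also have "\<dots> = block_entropy m + block_entropy n"
    using nn_integral_Tn[of "\<lambda>\<omega>. nlog (word_prob n (word n \<omega>))" m]
    by (subst nn_integral_add) (auto simp: block_entropy_def)
  finally show ?thesis .
qed

lemma block_entropy_0: "block_entropy 0 = 0"
  by (simp add: block_entropy_def word_prob_def prob_space)

end

section \<open>Limits of subadditive sequences\<close>

lemma fekete:
  fixes r :: "nat \<Rightarrow> real"
  assumes sub: "\<And>m n. r (m + n) \<le> r m + r n" and nonneg: "\<And>n. r n \<ge> 0"
  shows "\<exists>h. (\<lambda>n. r n / real n) \<longlonglongrightarrow> h"
proof -
  \<comment> \<open>Index 0 is left out: its quotient is 0 by convention and would spoil the
    infimum.\<close>
  define h where "h = (INF n\<in>{1..}. r n / real n)"
  have bdd: "bdd_below ((\<lambda>n. r n / real n) ` {1..})"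
    by (rule bdd_belowI[of _ 0]) (auto simp: nonneg)
  have "(\<lambda>n. r n / real n) \<longlonglongrightarrow> h"
  proof (rule LIMSEQ_I)
    fix e :: real assume e: "e > 0"
    obtain m where m: "m \<ge> 1" "r m / real m < h + e / 2"
      using cInf_lessD[of "(\<lambda>n. r n / real n) ` {1..}" "h + e/2"] e
      by (auto simp: h_def)
    define C where "C = (\<Sum>s<m. r s)"
    have C0: "C \<ge> 0" by (simp add: C_def sum_nonneg nonneg)
    have mult: "r (q * m + s) \<le> real q * r m + r s" for q s
    proof (induction q)
      case (Suc q)
      have "r (Suc q * m + s) = r (m + (q * m + s))" by (simp add: algebra_simps)
      also have "\<dots> \<le> r m + r (q * m + s)" by (rule sub)
      finally show ?case using Suc by (simp add: algebra_simps)
    qed simp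
    have bound: "r n \<le> real n * (r m / real m) + C" for n
    proof -
      have "r n \<le> real (n div m) * r m + r (n mod m)"
        using mult[of "n div m" "n mod m"] by simp
      also have "r (n mod m) \<le> C"
        unfolding C_def using m by (intro member_le_sum) (auto simp: nonneg)
      also have "real (n div m) * r m \<le> real n / real m * r m"
        by (intro mult_right_mono) (simp_all add: nonneg of_nat_div_le_of_nat)
      finally show ?thesis by simp
    qed
    obtain N where N: "real N > 2 * C / e" using reals_Archimedean2 by blast
    have "norm (r n / real n - h) < e" if n: "n \<ge> max 1 N" for n
    proof -
      have "h \<le> r n / real n" unfolding h_def using n by (intro cINF_lower bdd) auto
      moreover have "r n / real n < h + e"
      proof -
        have "2 * C / e < real n" using N n by (metis max.bounded_iff of_nat_le_iff order_less_le_trans)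
        then have "C / real n < e / 2" using e n by (simp add: field_simps)
        moreover have "r n / real n \<le> r m / real m + C / real n"
          using bound[of n] n by (simp add: field_simps)
        ultimately show ?thesis using m by linarith
      qed
      ultimately show ?thesis using e by (simp add: abs_if)
    qed
    then show "\<exists>no. \<forall>n\<ge>no. norm (r n / real n - h) < e" by blast
  qed
  then show ?thesis by blast
qed

section \<open>Parsing into high-probability blocks\<close>

lemma npd_weight_pos: "npd_weight l > 0"
  by (simp add: npd_weight_def frac_less2)

lemma npd_weight_sums: "npd_weight sums 1"
proof -
  have "(\<lambda>l. 1 / (real l + 1)) \<longlonglongrightarrow> 0" by real_asymp
  from telescope_sums'[OF this] show ?thesis
    by (simp add: npd_weight_def[abs_def] algebra_simps)
qed

lemma sum_npd_weight_le: "finite I \<Longrightarrow> sum npd_weight I \<le> 1"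
  using sum_le_suminf[of npd_weight I] npd_weight_sums npd_weight_pos
  by (auto simp: sums_iff less_imp_le)

context stationary_source
begin

text \<open>The renewal mixture over all decompositions of the word into blocks; the block lengths carry
  the weights of a probability distribution, so the total mass is at most 1.\<close>

fun parse :: "nat \<Rightarrow> 'b list \<Rightarrow> real" where
  "parse 0 w = 1"
| "parse (Suc n) w = (\<Sum>l\<le>n. npd_weight l *
     (word_prob (Suc l) (take (Suc l) w) * parse (n - l) (drop (Suc l) w)))"

lemma parse_nonneg: "parse n w \<ge> 0"
  by (induction n w rule: parse.induct) (auto intro!: sum_nonneg mult_nonneg_nonneg less_imp_le[OF npd_weight_pos])

text \<open>For each length of the first block, \<open>word_sum_append\<close> multiplies the mass 1
  of the block by the mass of the rest, at most 1 by induction; the weights of the lengths sum to at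
  most 1.\<close>

lemma word_sum_parse: "word_sum n (\<lambda>w. ennreal (parse n w)) \<le> 1"
proof (induction n rule: less_induct)
  case (less n)
  show ?case
  proof (cases n)
    case (Suc k)
    have "word_sum n (\<lambda>w. ennreal (parse n w)) = word_sum n (\<lambda>w. \<Sum>l\<le>k. ennreal (npd_weight l) *
        (ennreal (word_prob (Suc l) (take (Suc l) w)) * ennreal (parse (k - l) (drop (Suc l) w))))"
      by (intro arg_cong[where f="word_sum n"] ext)
         (simp add: Suc parse_nonneg less_imp_le[OF npd_weight_pos] flip: ennreal_mult sum_ennreal)
    also have "\<dots> = (\<Sum>l\<le>k. ennreal (npd_weight l) * word_sum n (\<lambda>w.
        ennreal (word_prob (Suc l) (take (Suc l) w)) * ennreal (parse (k - l) (drop (Suc l) w))))"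
      by (simp add: word_sum_sum word_sum_cmult)
    also have "\<dots> \<le> (\<Sum>l\<le>k. ennreal (npd_weight l) * 1)"
    proof (intro sum_mono mult_left_mono)
      fix l assume "l \<in> {..k}"
      then have "Suc l + (k - l) = n" using Suc by simp
      then show "word_sum n (\<lambda>w. ennreal (word_prob (Suc l) (take (Suc l) w)) * ennreal (parse (k - l) (drop (Suc l) w))) \<le> 1"
        using word_sum_append[of "Suc l" "k - l" "\<lambda>w. ennreal (word_prob (Suc l) w)" "\<lambda>w. ennreal (parse (k - l) w)"]
          less[of "k - l"] Suc by (simp add: word_sum_word_prob del: word_sum.simps)
    qed simp
    also have "\<dots> = ennreal (\<Sum>l\<le>k. npd_weight l)"
      by (simp add: less_imp_le[OF npd_weight_pos])
    also have "\<dots> \<le> 1" using sum_npd_weight_le[of "{..k}"] by (simp add: ennreal_le_1)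
    finally show ?thesis .
  qed simp
qed

lemma parse_ge:
  assumes "l \<le> n"
  shows "npd_weight l * (word_prob (Suc l) (take (Suc l) w) * parse (n - l) (drop (Suc l) w)) \<le> parse (Suc n) w"
  unfolding parse.simps
  by (rule member_le_sum) (use assms in \<open>auto intro!: mult_nonneg_nonneg less_imp_le[OF npd_weight_pos] parse_nonneg\<close>)

text \<open>Keeping a single summand of the mixture fixes the first block at length
  \<open>l + 1\<close>; the price is that of its weight, of the block and of the rest.\<close>

lemma nlog_parse_word:
  assumes "l \<le> n"
  shows "nlog (parse (Suc n) (word (Suc n) \<omega>)) \<le> nlog (npd_weight l) +
     nlog (word_prob (Suc l) (word (Suc l) \<omega>)) + nlog (parse (n - l) (word (n - l) ((T ^^ Suc l) \<omega>)))"
proof -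
  have eq: "Suc n = Suc l + (n - l)" using assms by simp
  let ?a = "word_prob (Suc l) (word (Suc l) \<omega>)"
  let ?b = "parse (n - l) (word (n - l) ((T ^^ Suc l) \<omega>))"
  have "npd_weight l * (?a * ?b) \<le> parse (Suc n) (word (Suc n) \<omega>)"
    using parse_ge[OF assms, of "word (Suc n) \<omega>"] take_word[of "Suc l" "n - l" \<omega>] drop_word[of "Suc l" "n - l" \<omega>]
    unfolding eq[symmetric] by simp
  then have "nlog (parse (Suc n) (word (Suc n) \<omega>)) \<le> nlog (npd_weight l * (?a * ?b))"
    by (rule nlog_antimono)
  also have "\<dots> \<le> nlog (npd_weight l) + nlog (?a * ?b)"
    by (intro nlog_mult mult_nonneg_nonneg less_imp_le[OF npd_weight_pos] parse_nonneg word_prob_nonneg)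
  also have "\<dots> \<le> nlog (npd_weight l) + (nlog ?a + nlog ?b)"
    by (intro add_left_mono nlog_mult parse_nonneg word_prob_nonneg)
  finally show ?thesis by (simp add: add.assoc)
qed

text \<open>\<open>d r\<close> is charged with \<open>r\<close> letters left, the current one
  included, so a charge can depend on whether a long block still fits.\<close>

primrec total_charge :: "(nat \<Rightarrow> 'w \<Rightarrow> ennreal) \<Rightarrow> nat \<Rightarrow> 'w \<Rightarrow> ennreal" where
  "total_charge d 0 \<omega> = 0"
| "total_charge d (Suc n) \<omega> = d (Suc n) \<omega> + total_charge d n (T \<omega>)"

lemma total_charge_shift: "total_charge d n ((T ^^ m) \<omega>) \<le> total_charge d (m + n) \<omega>"
proof (induction m arbitrary: \<omega>)
  case (Suc m)
  show ?case using Suc[of "T \<omega>"] by (simp add: funpow_swap1 add_increasing)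
qed simp

lemma total_charge_meas [measurable]:
  "(\<And>r. d r \<in> borel_measurable M) \<Longrightarrow> total_charge d n \<in> borel_measurable M"
  by (induction n) (simp_all add: total_charge.simps[abs_def] del: total_charge.simps)

lemma nn_integral_total_charge:
  assumes [measurable]: "\<And>r. d r \<in> borel_measurable M"
  shows "(\<integral>\<^sup>+\<omega>. total_charge d n \<omega> \<partial>M) = (\<Sum>r<n. \<integral>\<^sup>+\<omega>. d (Suc r) \<omega> \<partial>M)"
  by (induction n) (simp_all add: nn_integral_add nn_integral_T add.commute)

text \<open>"Short" refers to the code length, at most \<open>c\<close> per letter. The lower limit
  \<open>M0\<close> makes the weight of the block length cheap per letter; the upper limit
  \<open>M1\<close> guarantees that the block fits when \<open>M1\<close> letters remain.\<close>

definition short_block :: "real \<Rightarrow> nat \<Rightarrow> nat \<Rightarrow> 'w \<Rightarrow> bool" where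
  "short_block c M0 M1 \<omega> \<longleftrightarrow>
     (\<exists>l\<in>{M0..<M1}. nlog (word_prob (Suc l) (word (Suc l) \<omega>)) \<le> ennreal (real (Suc l) * c))"

lemma short_block_meas [measurable]: "Measurable.pred M (short_block c M0 M1)"
  unfolding short_block_def by measurable

definition symbol_cost :: "'w \<Rightarrow> ennreal" where
  "symbol_cost \<omega> = nlog (npd_weight 0) + nlog (word_prob 1 (word 1 \<omega>))"

lemma symbol_cost_meas [measurable]: "symbol_cost \<in> borel_measurable M"
  unfolding symbol_cost_def by measurable

text \<open>If a short block starts here and fits, it is taken, at \<open>c\<close> per letter for
  the block and \<open>e\<close> per letter for its weight. Otherwise one letter becomes a block of
  its own, charged \<open>symbol_cost\<close>.\<close>

lemma greedy_parse:
  fixes M0 M1 :: nat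
  assumes c: "c \<ge> 0" "e \<ge> 0"
    and wt: "\<And>l. l \<ge> M0 \<Longrightarrow> nlog (npd_weight l) \<le> ennreal (real (Suc l) * e)"
  defines "d \<equiv> (\<lambda>r \<omega>. if short_block c M0 M1 \<omega> \<and> M1 \<le> r then 0 else symbol_cost \<omega>)"
  shows "nlog (parse n (word n \<omega>)) \<le> ennreal (real n * (c + e)) + total_charge d n \<omega>"
proof (induction n arbitrary: \<omega> rule: less_induct)
  case (less n)
  show ?case
  proof (cases n)
    case (Suc k)
    show ?thesis
    proof (cases "short_block c M0 M1 \<omega> \<and> M1 \<le> n")
      case True
      then obtain l where l: "l \<ge> M0" "l < M1" "nlog (word_prob (Suc l) (word (Suc l) \<omega>)) \<le> ennreal (real (Suc l) * c)"
        by (auto simp: short_block_def)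
      have lk: "l \<le> k" using l True Suc by simp
      have "nlog (parse n (word n \<omega>)) \<le> nlog (npd_weight l) +
          nlog (word_prob (Suc l) (word (Suc l) \<omega>)) + nlog (parse (k - l) (word (k - l) ((T ^^ Suc l) \<omega>)))"
        unfolding Suc by (rule nlog_parse_word[OF lk])
      also have "\<dots> \<le> ennreal (real (Suc l) * e) + ennreal (real (Suc l) * c)
          + (ennreal (real (k - l) * (c + e)) + total_charge d (k - l) ((T ^^ Suc l) \<omega>))"
        using lk Suc by (intro add_mono wt l less) auto
      \<comment> \<open>Positions inside the block are charged although the code skips them. This
        overcount makes the charge additive along the orbit, so stationarity gives its mean.\<close>
      also have "total_charge d (k - l) ((T ^^ Suc l) \<omega>) \<le> total_charge d n \<omega>"
        using total_charge_shift[of d "k - l" "Suc l" \<omega>] lk Suc by (simp del: funpow.simps total_charge.simps)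
      also have "ennreal (real (Suc l) * e) + ennreal (real (Suc l) * c) + (ennreal (real (k - l) * (c + e)) + total_charge d n \<omega>)
          = ennreal (real (Suc l) * e + real (Suc l) * c + real (k - l) * (c + e)) + total_charge d n \<omega>"
        using c by (simp add: add.assoc del: of_nat_Suc)
      also have "real (Suc l) * e + real (Suc l) * c + real (k - l) * (c + e) = real n * (c + e)"
        using lk Suc by (simp add: of_nat_diff algebra_simps)
      finally show ?thesis by simp
    next
      case False
      then have d: "d n \<omega> = symbol_cost \<omega>" by (auto simp: d_def)
      have "nlog (parse n (word n \<omega>)) \<le> symbol_cost \<omega> + nlog (parse k (word k (T \<omega>)))"
        using nlog_parse_word[of 0 k \<omega>] by (simp add: Suc symbol_cost_def del: parse.simps)
      also have "\<dots> \<le> symbol_cost \<omega> + (ennreal (real k * (c + e)) + total_charge d k (T \<omega>))"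
        using Suc by (intro add_left_mono less) auto
      also have "\<dots> \<le> symbol_cost \<omega> + (ennreal (real n * (c + e)) + total_charge d k (T \<omega>))"
        using Suc c by (intro add_left_mono add_right_mono ennreal_leI mult_right_mono) auto
      also have "\<dots> = ennreal (real n * (c + e)) + total_charge d n \<omega>"
        using d by (simp add: Suc algebra_simps del: of_nat_Suc)
      finally show ?thesis .
    qed
  qed simp
qed

text \<open>The three terms pay for the blocks, for letters coded singly because no short block
  starts there, and for the last \<open>M1\<close> letters, where a block may not fit.\<close>

lemma block_entropy_le_charge:
  assumes c: "c \<ge> 0" "e \<ge> 0"
    and wt: "\<And>l. l \<ge> M0 \<Longrightarrow> nlog (npd_weight l) \<le> ennreal (real (Suc l) * e)"
  shows "block_entropy n \<le> ennreal (real n * (c + e))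
     + of_nat n * (\<integral>\<^sup>+\<omega>. (if short_block c M0 M1 \<omega> then 0 else symbol_cost \<omega>) \<partial>M)
     + of_nat M1 * (\<integral>\<^sup>+\<omega>. symbol_cost \<omega> \<partial>M)"
proof -
  define d where "d = (\<lambda>r \<omega>. if short_block c M0 M1 \<omega> \<and> M1 \<le> (r::nat) then 0 else symbol_cost \<omega>)"
  have [measurable]: "d r \<in> borel_measurable M" for r by (simp add: d_def)
  let ?B = "\<integral>\<^sup>+\<omega>. (if short_block c M0 M1 \<omega> then 0 else symbol_cost \<omega>) \<partial>M"
  let ?K = "\<integral>\<^sup>+\<omega>. symbol_cost \<omega> \<partial>M"
  have "block_entropy n \<le> (\<integral>\<^sup>+\<omega>. nlog (parse n (word n \<omega>)) \<partial>M)"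
    by (intro gibbs parse_nonneg word_sum_parse)
  also have "\<dots> \<le> (\<integral>\<^sup>+\<omega>. ennreal (real n * (c + e)) + total_charge d n \<omega> \<partial>M)"
    unfolding d_def by (intro nn_integral_mono greedy_parse c wt)
  also have "\<dots> = ennreal (real n * (c + e)) + (\<Sum>r<n. \<integral>\<^sup>+\<omega>. d (Suc r) \<omega> \<partial>M)"
    by (simp add: nn_integral_add nn_integral_total_charge emeasure_space_1)
  also have "(\<Sum>r<n. \<integral>\<^sup>+\<omega>. d (Suc r) \<omega> \<partial>M) \<le> (\<Sum>r<n. ?B + (if r < M1 then ?K else 0))"
  proof (rule sum_mono)
    fix r
    show "(\<integral>\<^sup>+\<omega>. d (Suc r) \<omega> \<partial>M) \<le> ?B + (if r < M1 then ?K else 0)"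
    proof (cases "r < M1")
      case True
      then show ?thesis by (auto simp: d_def intro!: add_increasing nn_integral_mono)
    next
      case False
      then have "d (Suc r) = (\<lambda>\<omega>. if short_block c M0 M1 \<omega> then 0 else symbol_cost \<omega>)"
        by (auto simp: d_def)
      then show ?thesis using False by simp
    qed
  qed
  also have "\<dots> = of_nat n * ?B + (\<Sum>r\<in>{..<n} \<inter> {..<M1}. ?K)"
    using sum.inter_restrict[of "{..<n}" "\<lambda>_. ?K" "{..<M1}"] by (simp add: sum.distrib)
  also have "(\<Sum>r\<in>{..<n} \<inter> {..<M1}. ?K) \<le> (\<Sum>r\<in>{..<M1}. ?K)"
    by (rule sum_mono2) auto
  finally show ?thesis by (simp add: add.assoc add_left_mono)
qed

lemma block_entropy_finite: "block_entropy 1 < \<infinity> \<Longrightarrow> block_entropy n < \<infinity>"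
proof (induction n)
  case (Suc n)
  then show ?case using block_entropy_add[of n 1] by (auto simp: le_less_trans ennreal_add_less_top)
qed (simp add: block_entropy_0)

definition rate :: real where
  "rate = lim (\<lambda>n. enn2real (block_entropy n) / real n)"

lemma rate_LIMSEQ:
  assumes "block_entropy 1 < \<infinity>"
  shows "(\<lambda>n. enn2real (block_entropy n) / real n) \<longlonglongrightarrow> rate"
proof -
  have "enn2real (block_entropy (m + n)) \<le> enn2real (block_entropy m) + enn2real (block_entropy n)" for m n
    using block_entropy_add[of m n] block_entropy_finite[OF assms]
    by (simp flip: enn2real_plus add: enn2real_mono ennreal_add_less_top)
  then show ?thesis
    using fekete[of "\<lambda>n. enn2real (block_entropy n)"] by (auto simp: rate_def limI)
qed

text \<open>The greedy code spends at most \<open>c\<close> per letter on its blocks. One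
  \<open>e\<close> pays for the weights, by the choice of \<open>M0\<close>, the other for letters
  coded singly, by the choice of \<open>M1\<close>; the end of the word is negligible per
  letter.\<close>

lemma rate_le_of_short_blocks:
  assumes fin: "block_entropy 1 < \<infinity>" and c: "c \<ge> 0" "e > 0"
    and short: "\<And>M0. AE \<omega> in M. \<exists>l\<ge>M0. nlog (word_prob (Suc l) (word (Suc l) \<omega>)) \<le> ennreal (real (Suc l) * c)"
  shows "rate \<le> c + 2 * e"
proof -
  obtain M0 where M0: "\<And>l. l \<ge> M0 \<Longrightarrow> nlog (npd_weight l) \<le> ennreal (real (Suc l) * e)"
  proof -
    have "(\<lambda>l. - ln (npd_weight l) / real (Suc l)) \<longlonglongrightarrow> 0"
      unfolding npd_weight_def by real_asymp
    then have "eventually (\<lambda>l. - ln (npd_weight l) / real (Suc l) < e) sequentially"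
      using c by (intro order_tendstoD)
    then obtain M0 where "\<And>l. l \<ge> M0 \<Longrightarrow> - ln (npd_weight l) / real (Suc l) < e"
      by (auto simp: eventually_sequentially)
    then have "l \<ge> M0 \<Longrightarrow> - ln (npd_weight l) \<le> real (Suc l) * e" for l
      by (fastforce simp: field_simps)
    then show ?thesis
      by (intro that) (auto simp: nlog_pos npd_weight_pos intro!: ennreal_leI)
  qed
  define K where "K = (\<integral>\<^sup>+\<omega>. symbol_cost \<omega> \<partial>M)"
  have K: "K < \<infinity>"
    using fin by (simp add: K_def symbol_cost_def nn_integral_add block_entropy_def emeasure_space_1
        nlog_pos npd_weight_pos ennreal_add_less_top)
  define f where "f = (\<lambda>M1 \<omega>. if short_block c M0 M1 \<omega> then 0 else symbol_cost \<omega>)"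
  have f_meas [measurable]: "f M1 \<in> borel_measurable M" for M1 by (simp add: f_def)
  \<comment> \<open>As \<open>M1\<close> grows, a short block starts at almost every point sooner or
    later; \<open>symbol_cost\<close> has finite mean and dominates.\<close>
  have "(\<lambda>M1. \<integral>\<^sup>+\<omega>. f M1 \<omega> \<partial>M) \<longlonglongrightarrow> (\<integral>\<^sup>+\<omega>. 0 \<partial>M)"
  proof (rule nn_integral_dominated_convergence[where w=symbol_cost])
    show "AE \<omega> in M. (\<lambda>M1. f M1 \<omega>) \<longlonglongrightarrow> 0"
      using short[of M0]
    proof eventually_elim
      case (elim \<omega>)
      then obtain l where "l \<ge> M0" "nlog (word_prob (Suc l) (word (Suc l) \<omega>)) \<le> ennreal (real (Suc l) * c)"
        by blast
      then have "f M1 \<omega> = 0" if "M1 \<ge> Suc l" for M1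
        using that by (auto simp: f_def short_block_def)
      then show ?case
        by (intro tendsto_eventually) (auto simp: eventually_sequentially)
    qed
  qed (use K in \<open>auto simp: f_def K_def\<close>)
  then have "eventually (\<lambda>M1. (\<integral>\<^sup>+\<omega>. f M1 \<omega> \<partial>M) < ennreal e) sequentially"
    using c by (intro order_tendstoD) auto
  then obtain M1 where M1: "(\<integral>\<^sup>+\<omega>. f M1 \<omega> \<partial>M) \<le> ennreal e"
    using eventually_happens'[OF sequentially_bot] less_imp_le by metis
  have "enn2real (block_entropy n) / real n \<le> c + 2 * e + real M1 * enn2real K / real n" if n: "n > 0" for n
  proof -
    have "block_entropy n \<le> ennreal (real n * (c + e)) + of_nat n * (\<integral>\<^sup>+\<omega>. f M1 \<omega> \<partial>M) + of_nat M1 * K"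
      unfolding f_def K_def using c by (intro block_entropy_le_charge M0) auto
    also have "\<dots> \<le> ennreal (real n * (c + e)) + of_nat n * ennreal e + of_nat M1 * ennreal (enn2real K)"
      using M1 K by (intro add_mono mult_left_mono) auto
    also have "\<dots> = ennreal (real n * (c + e) + real n * e + real M1 * enn2real K)"
      using c by (simp add: ennreal_of_nat_eq_real_of_nat flip: ennreal_mult)
    finally have "enn2real (block_entropy n) \<le> real n * (c + e) + real n * e + real M1 * enn2real K"
      using c by (intro enn2real_leI) auto
    then show ?thesis using n by (simp add: field_simps)
  qed
  moreover have "(\<lambda>n. c + 2 * e + real M1 * enn2real K / real n) \<longlonglongrightarrow> c + 2 * e + 0"
    by (intro tendsto_add tendsto_const lim_const_over_n)
  ultimately have "rate \<le> c + 2 * e + 0"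
    by (intro LIMSEQ_le[OF rate_LIMSEQ[OF fin]] exI[of _ 1]) auto
  then show ?thesis by simp
qed

lemma vimage_Tn_prob:
  assumes [measurable]: "A \<in> sets M"
  shows "prob ((T ^^ n) -` A \<inter> space M) = prob A"
proof -
  have "emeasure M ((T ^^ n) -` A \<inter> space M) = (\<integral>\<^sup>+\<omega>. indicator A ((T ^^ n) \<omega>) \<partial>M)"
    by (subst nn_integral_indicator[symmetric])
       (auto intro!: nn_integral_cong simp: measurable_sets simp del: nn_integral_indicator split: split_indicator)
  also have "\<dots> = emeasure M A"
    using nn_integral_Tn[of "indicator A" n] by simp
  finally show ?thesis by (simp add: measure_def)
qed

end

section \<open>Ergodicity: the lower bound for the information and half of the ergodic
  theorem\<close>

locale ergodic_source = stationary_source +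
  assumes ergodic: "\<And>A. A \<in> sets M \<Longrightarrow> T -` A \<inter> space M = A \<Longrightarrow> prob A = 0 \<or> prob A = 1"
begin

lemma T_space: "\<omega> \<in> space M \<Longrightarrow> T \<omega> \<in> space M"
  using measurable_space[OF T_meas] .

text \<open>The preimages of \<open>A\<close> under the iterates of \<open>T\<close> increase and
  all have the probability of \<open>A\<close>; their union is strictly invariant.\<close>

lemma forward_invariant:
  assumes A [measurable]: "A \<in> sets M" and inv: "\<And>\<omega>. \<omega> \<in> A \<Longrightarrow> T \<omega> \<in> A"
  shows "prob A = 0 \<or> prob A = 1"
proof -
  define B where "B n = (T ^^ n) -` A \<inter> space M" for n
  have B_sets: "B n \<in> sets M" for n unfolding B_def by measurable
  have B_Suc: "T -` B n \<inter> space M = B (Suc n)" for n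
    by (auto simp: B_def funpow_swap1 T_space)
  have "incseq B"
    using inv by (intro incseq_SucI) (auto simp: B_def)
  then have "T -` (\<Union>n. B n) \<inter> space M = (\<Union>n. B n)"
    using B_Suc by (auto simp: vimage_Union incseq_Suc_iff) blast+
  moreover have "(\<Union>n. B n) \<in> sets M" using B_sets by auto
  ultimately have "prob (\<Union>n. B n) = 0 \<or> prob (\<Union>n. B n) = 1"
    by (intro ergodic)
  moreover have "(\<lambda>n. prob (B n)) \<longlonglongrightarrow> prob (\<Union>n. B n)"
    using B_sets \<open>incseq B\<close> by (intro finite_Lim_measure_incseq) auto
  moreover have "(\<lambda>n. prob (B n)) \<longlonglongrightarrow> prob A"
    by (simp add: B_def vimage_Tn_prob)
  ultimately have "prob (\<Union>n. B n) = 0 \<or> prob (\<Union>n. B n) = 1" "prob (\<Union>n. B n) = prob A"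
    by (auto intro: LIMSEQ_unique)
  then show ?thesis by simp
qed

lemma information_lower_bound:
  assumes fin: "block_entropy 1 < \<infinity>" and c: "c < rate" "c \<ge> 0"
  shows "AE \<omega> in M. eventually (\<lambda>n. nlog (word_prob n (word n \<omega>)) > ennreal (real n * c)) sequentially"
proof -
  define A where "A = {\<omega> \<in> space M. \<exists>K::nat. \<forall>m. \<exists>l\<ge>m. nlog (word_prob l (word l \<omega>)) \<le> ennreal (real l * c + real K)}"
  have A [measurable]: "A \<in> sets M" unfolding A_def by measurable
  \<comment> \<open>The slack \<open>K\<close> makes \<open>A\<close> invariant: dropping the first symbol shifts it by \<open>c\<close>.\<close>
  have "T \<omega> \<in> A" if "\<omega> \<in> A" for \<omega>
  proof -
    from that obtain K where K: "\<And>m. \<exists>l\<ge>m. nlog (word_prob l (word l \<omega>)) \<le> ennreal (real l * c + real K)"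
      and sp: "\<omega> \<in> space M" by (auto simp: A_def)
    obtain K' :: nat where K': "real K' \<ge> real K + c" using real_arch_simple by blast
    have "\<exists>l\<ge>m. nlog (word_prob l (word l (T \<omega>))) \<le> ennreal (real l * c + real K')" for m
    proof -
      obtain l where l: "l \<ge> Suc m" "nlog (word_prob l (word l \<omega>)) \<le> ennreal (real l * c + real K)"
        using K by blast
      then obtain k where k: "l = Suc k" "k \<ge> m" by (cases l) auto
      \<comment> \<open>The cylinder of the longer word lies in the \<open>T\<close>-preimage of the
        cylinder of its tail, so by stationarity the tail is at least as probable.\<close>
      have "word_prob (Suc k) (word (Suc k) \<omega>) \<le> prob (T -` {\<omega>' \<in> space M. word k \<omega>' = word k (T \<omega>)} \<inter> space M)"
        unfolding word_prob_def by (intro finite_measure_mono) (auto simp: T_space)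
      also have "\<dots> = word_prob k (word k (T \<omega>))"
        unfolding word_prob_def using vimage_Tn_prob[of "{\<omega>' \<in> space M. word k \<omega>' = word k (T \<omega>)}" 1] by simp
      finally have "nlog (word_prob k (word k (T \<omega>))) \<le> nlog (word_prob (Suc k) (word (Suc k) \<omega>))"
        by (rule nlog_antimono)
      also have "\<dots> \<le> ennreal (real l * c + real K)" using l k by simp
      also have "\<dots> \<le> ennreal (real k * c + real K')"
        using k K' by (intro ennreal_leI) (simp add: algebra_simps)
      finally show ?thesis using k by blast
    qed
    then show ?thesis using sp by (auto simp: A_def T_space)
  qed
  then consider "prob A = 0" | "prob A = 1" using forward_invariant[OF A] by blast
  then show ?thesis
  proof cases
    case 1
    then have "AE \<omega> in M. \<omega> \<notin> A"
      using A by (simp add: AE_iff_measurable[OF A] prob_eq_0 emeasure_eq_measure)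
    then show ?thesis
      using AE_space
    proof eventually_elim
      case (elim \<omega>)
      then have "\<not> (\<exists>K::nat. \<forall>m. \<exists>l\<ge>m. nlog (word_prob l (word l \<omega>)) \<le> ennreal (real l * c + real K))"
        by (simp add: A_def)
      then have "\<not> (\<forall>m. \<exists>l\<ge>m. nlog (word_prob l (word l \<omega>)) \<le> ennreal (real l * c + real 0))"
        by (rule contrapos_nn) (rule exI[of _ 0])
      then show ?case by (force simp: eventually_sequentially not_le not_less)
    qed
  next
    case 2
    \<comment> \<open>One \<open>e\<close> absorbs the slack \<open>K\<close> once \<open>l\<close>
      is at least \<open>K / e\<close>, and \<open>rate_le_of_short_blocks\<close> costs two more. A
      quarter of the gap makes \<open>rate \<le> c + 3 * e\<close> absurd.\<close>
    define e where "e = (rate - c) / 4"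
    have e: "e > 0" using c by (simp add: e_def)
    have "AE \<omega> in M. \<exists>l\<ge>M0. nlog (word_prob (Suc l) (word (Suc l) \<omega>)) \<le> ennreal (real (Suc l) * (c + e))" for M0
      using AE_prob_1[OF 2]
    proof eventually_elim
        case (elim \<omega>)
        then obtain K where K: "\<And>m. \<exists>l\<ge>m. nlog (word_prob l (word l \<omega>)) \<le> ennreal (real l * c + real K)"
          by (auto simp: A_def)
        obtain N :: nat where N: "real N \<ge> real K / e" using real_arch_simple by blast
        obtain l where l: "l \<ge> max (Suc M0) N" "nlog (word_prob l (word l \<omega>)) \<le> ennreal (real l * c + real K)"
          using K by blast
        then obtain k where k: "l = Suc k" "k \<ge> M0" by (cases l) auto
        have "real K / e \<le> real l" using N l by linarith
        then have "real l * c + real K \<le> real l * (c + e)"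
          using e by (simp add: field_simps)
        then show ?case using l k by (metis ennreal_leI order_trans)
    qed
    from rate_le_of_short_blocks[OF fin _ e this] e c have "rate \<le> c + e + 2 * e" by simp
    then show ?thesis using e unfolding e_def by argo
  qed
qed

text \<open>The maximum of the Birkhoff sums of lengths 1 to \<open>n + 1\<close>, in recursive
  form.\<close>

fun window_max :: "('a \<Rightarrow> real) \<Rightarrow> nat \<Rightarrow> 'a \<Rightarrow> real" where
  "window_max f 0 \<omega> = f \<omega>"
| "window_max f (Suc n) \<omega> = f \<omega> + max 0 (window_max f n (T \<omega>))"

lemma window_max_mono: "window_max f n \<omega> \<le> window_max f (Suc n) \<omega>"
proof (induction n arbitrary: \<omega>)
  case (Suc n)
  show ?case using Suc[of "T \<omega>"] by simp
qed simp

lemma sum_le_window_max: "(\<Sum>i<Suc n. f ((T ^^ i) \<omega>)) \<le> window_max f n \<omega>"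
proof (induction n arbitrary: \<omega>)
  case (Suc n)
  show ?case using Suc[of "T \<omega>"]
    by (subst sum.lessThan_Suc_shift) (simp add: funpow_swap1 del: sum.lessThan_Suc)
qed simp

lemma integrable_T:
  assumes "integrable M (f :: 'a \<Rightarrow> real)"
  shows "integrable M (\<lambda>\<omega>. f (T \<omega>))" and "(\<integral>\<omega>. f (T \<omega>) \<partial>M) = (\<integral>\<omega>. f \<omega> \<partial>M)"
  using integrable_distr[OF T_meas, of f] integral_distr[OF T_meas, of f] assms by (simp_all add: T_inv)

lemma integrable_window_max: "integrable M f \<Longrightarrow> integrable M (window_max f n)"
  by (induction n) (auto simp: window_max.simps[abs_def] intro!: integrable_max integrable_T(1)[of "window_max f n" for n])

text \<open>Garsia's argument for the maximal ergodic theorem.\<close>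

lemma birkhoff_sums_bounded:
  fixes f :: "'a \<Rightarrow> real"
  assumes f: "integrable M f" and neg: "(\<integral>\<omega>. f \<omega> \<partial>M) < 0"
  shows "AE \<omega> in M. \<exists>K. \<forall>n. (\<Sum>i<n. f ((T ^^ i) \<omega>)) \<le> K"
proof -
  note [measurable] = borel_measurable_integrable[OF f] borel_measurable_integrable[OF integrable_window_max[OF f]]
  define A where "A = {\<omega> \<in> space M. \<forall>K::nat. \<exists>n. window_max f n \<omega> > real K}"
  have A [measurable]: "A \<in> sets M" unfolding A_def by measurable
  have fwd: "T \<omega> \<in> A" if "\<omega> \<in> A" for \<omega>
  proof -
    have "\<exists>n. window_max f n (T \<omega>) > real K" for K
    proof -
      obtain K' :: nat where K': "real K' \<ge> real K + f \<omega>" using real_arch_simple by blast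
      obtain n where "window_max f n \<omega> > real K'" using \<open>\<omega> \<in> A\<close> by (auto simp: A_def)
      then have "window_max f (Suc n) \<omega> > real K'" using window_max_mono[of f n \<omega>] by linarith
      then show ?thesis using K' by (intro exI[of _ n]) (auto simp: max_def split: if_splits)
    qed
    then show ?thesis using that by (auto simp: A_def T_space)
  qed
  have "prob A \<noteq> 1"
  proof
    assume "prob A = 1"
    \<comment> \<open>Invariance and monotonicity in \<open>n\<close> make the integral of
      \<open>?g n\<close> nonnegative. On \<open>A\<close> the shifted maximum is eventually
      positive, so \<open>max 0\<close> has no effect and \<open>?g n\<close> equals
      \<open>f\<close>; in the limit this contradicts the negative mean.\<close>
    let ?g = "\<lambda>n \<omega>. window_max f (Suc n) \<omega> - window_max f n (T \<omega>)"
    have int: "integrable M (window_max f n)" "integrable M (\<lambda>\<omega>. window_max f n (T \<omega>))" for n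
      using integrable_window_max[OF f] integrable_T(1) by auto
    have "(\<integral>\<omega>. ?g n \<omega> \<partial>M) \<ge> 0" for n
    proof -
      have "(\<integral>\<omega>. ?g n \<omega> \<partial>M) = (\<integral>\<omega>. window_max f (Suc n) \<omega> \<partial>M) - (\<integral>\<omega>. window_max f n \<omega> \<partial>M)"
        using int by (subst Bochner_Integration.integral_diff) (simp_all add: integrable_T(2) del: window_max.simps)
      also have "\<dots> \<ge> 0"
        using integral_mono[OF int(1)[of n] int(1)[of "Suc n"] window_max_mono] by simp
      finally show ?thesis .
    qed
    moreover have "(\<lambda>n. \<integral>\<omega>. ?g n \<omega> \<partial>M) \<longlonglongrightarrow> (\<integral>\<omega>. f \<omega> \<partial>M)"
    proof (rule integral_dominated_convergence[where w="\<lambda>\<omega>. \<bar>f \<omega>\<bar> + \<bar>f (T \<omega>)\<bar>"])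
      show "integrable M (\<lambda>\<omega>. \<bar>f \<omega>\<bar> + \<bar>f (T \<omega>)\<bar>)"
        using f integrable_T(1)[OF f] by auto
      \<comment> \<open>\<open>?g n\<close> exceeds \<open>f\<close> by the negative part of the
        shifted maximum, and this lower bound dominates that part independently of
        \<open>n\<close>.\<close>
      have "window_max f n (T \<omega>) \<ge> f (T \<omega>)" for n \<omega>
        by (cases n) auto
      then show "AE \<omega> in M. norm (?g n \<omega>) \<le> \<bar>f \<omega>\<bar> + \<bar>f (T \<omega>)\<bar>" for n
        by (intro AE_I2) (smt (verit) real_norm_def window_max.simps(2))
      show "AE \<omega> in M. (\<lambda>n. ?g n \<omega>) \<longlonglongrightarrow> f \<omega>"
        using AE_prob_1[OF \<open>prob A = 1\<close>]
      proof eventually_elim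
        case (elim \<omega>)
        then have "T \<omega> \<in> A" by (rule fwd)
        then have "\<exists>n. window_max f n (T \<omega>) > real 0" unfolding A_def by blast
        then obtain n where n: "window_max f n (T \<omega>) > real 0" by blast
        have "window_max f k (T \<omega>) > 0" if "k \<ge> n" for k
          using lift_Suc_mono_le[of "\<lambda>k. window_max f k (T \<omega>)" n k] window_max_mono n that by fastforce
        then have "?g k \<omega> = f \<omega>" if "k \<ge> n" for k using that by fastforce
        then show ?case by (intro tendsto_eventually) (auto simp: eventually_sequentially)
      qed
    qed (use f int in measurable)
    ultimately have "(\<integral>\<omega>. f \<omega> \<partial>M) \<ge> 0"
      by (intro LIMSEQ_le_const) auto
    then show False using neg by simp
  qed
  then have "prob A = 0" using forward_invariant[OF A fwd] by blast
  then have "AE \<omega> in M. \<omega> \<notin> A"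
    by (simp add: AE_iff_measurable[OF A] prob_eq_0 emeasure_eq_measure)
  then show ?thesis
    using AE_space
  proof eventually_elim
    case (elim \<omega>)
    then obtain K :: nat where K: "\<And>n. window_max f n \<omega> \<le> real K" by (auto simp: A_def not_less)
    have "(\<Sum>i<n. f ((T ^^ i) \<omega>)) \<le> real K" for n
      using sum_le_window_max[where f=f and \<omega>=\<omega>] K by (cases n) (auto intro: order_trans simp del: sum.lessThan_Suc)
    then show ?case by blast
  qed
qed

text \<open>\<open>f - a\<close> has negative mean. This is the upper half of Birkhoff's theorem,
  with an additive constant depending on the path in place of a limit.\<close>

lemma birkhoff_upper:
  fixes f :: "'a \<Rightarrow> real"
  assumes f: "integrable M f" and a: "(\<integral>\<omega>. f \<omega> \<partial>M) < a"
  shows "AE \<omega> in M. \<exists>K. \<forall>n. (\<Sum>i<n. f ((T ^^ i) \<omega>)) \<le> real n * a + K"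
proof -
  have "AE \<omega> in M. \<exists>K. \<forall>n. (\<Sum>i<n. f ((T ^^ i) \<omega>) - a) \<le> K"
    using assms by (intro birkhoff_sums_bounded[of "\<lambda>\<omega>. f \<omega> - a"]) (auto simp: prob_space)
  then show ?thesis
    by eventually_elim (auto simp: sum_subtractf algebra_simps)
qed

end

section \<open>Almost sure lower bound for codes\<close>

context ergodic_source
begin

text \<open>The ratios of code to probability have mean at most 1. Divided by
  \<open>(n + 1)\<^sup>2\<close> they form a series of finite mean, hence almost surely summable,
  and its terms are eventually below 1. The factor is polynomial, so it costs nothing per letter in
  the limit.\<close>

lemma eventually_le_word_prob:
  assumes nonneg: "\<And>n w. 0 \<le> F n w" and sub: "\<And>n. word_sum n (\<lambda>w. ennreal (F n w)) \<le> 1"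
  shows "AE \<omega> in M. eventually (\<lambda>n. F n (word n \<omega>) \<le> (real n + 1)\<^sup>2 * word_prob n (word n \<omega>)) sequentially"
proof -
  define r where "r n \<omega> = F n (word n \<omega>) / word_prob n (word n \<omega>)" for n \<omega>
  have [measurable]: "r n \<in> borel_measurable M" for n
    unfolding r_def by measurable
  have r0: "r n \<omega> \<ge> 0" for n \<omega> by (simp add: r_def nonneg)
  have s: "summable (\<lambda>n. 1 / (real n + 1)\<^sup>2)"
    using inverse_power_summable[of 2, where 'a=real, THEN summable_ignore_initial_segment[of _ 1]]
    by (simp add: inverse_eq_divide add.commute)
  have "(\<integral>\<^sup>+\<omega>. (\<Sum>n. ennreal (r n \<omega> / (real n + 1)\<^sup>2)) \<partial>M) = (\<Sum>n. \<integral>\<^sup>+\<omega>. ennreal (r n \<omega> / (real n + 1)\<^sup>2) \<partial>M)"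
    by (intro nn_integral_suminf) measurable
  also have "\<dots> \<le> (\<Sum>n. ennreal (1 / (real n + 1)\<^sup>2))"
  proof (intro suminf_le allI)
    fix n
    have "(\<integral>\<^sup>+\<omega>. ennreal (r n \<omega> / (real n + 1)\<^sup>2) \<partial>M) = (\<integral>\<^sup>+\<omega>. ennreal (1 / (real n + 1)\<^sup>2) * ennreal (r n \<omega>) \<partial>M)"
      by (intro nn_integral_cong) (simp flip: ennreal_mult add: r0)
    also have "\<dots> = ennreal (1 / (real n + 1)\<^sup>2) * (\<integral>\<^sup>+\<omega>. ennreal (r n \<omega>) \<partial>M)"
      by (intro nn_integral_cmult) measurable
    also have "(\<integral>\<^sup>+\<omega>. ennreal (r n \<omega>) \<partial>M) \<le> 1"
      unfolding r_def by (rule order_trans[OF nn_integral_ratio_le sub]) (rule nonneg)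
    finally show "(\<integral>\<^sup>+\<omega>. ennreal (r n \<omega> / (real n + 1)\<^sup>2) \<partial>M) \<le> ennreal (1 / (real n + 1)\<^sup>2)"
      by (simp add: mult_left_mono)
  qed auto
  also have "\<dots> = ennreal (\<Sum>n. 1 / (real n + 1)\<^sup>2)"
    by (intro suminf_ennreal2 s) simp
  finally have "(\<integral>\<^sup>+\<omega>. (\<Sum>n. ennreal (r n \<omega> / (real n + 1)\<^sup>2)) \<partial>M) \<noteq> \<infinity>"
    by (auto simp: top_unique)
  then have "AE \<omega> in M. (\<Sum>n. ennreal (r n \<omega> / (real n + 1)\<^sup>2)) \<noteq> \<infinity>"
    by (intro nn_integral_PInf_AE) measurable
  moreover have "AE \<omega> in M. \<forall>n. word_prob n (word n \<omega>) > 0"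
    by (subst AE_all_countable) (auto intro: word_prob_pos)
  ultimately show ?thesis
  proof eventually_elim
    case (elim \<omega>)
    then have "summable (\<lambda>n. r n \<omega> / (real n + 1)\<^sup>2)"
      by (intro summable_suminf_not_top) (auto simp: r0)
    then have "eventually (\<lambda>n. r n \<omega> / (real n + 1)\<^sup>2 < 1) sequentially"
      by (intro order_tendstoD(2)[OF summable_LIMSEQ_zero]) auto
    then show ?case
    proof eventually_elim
      case n: (elim n)
      then have "r n \<omega> \<le> (real n + 1)\<^sup>2"
        by (simp add: divide_less_eq)
      then show ?case using elim(2) by (simp add: r_def pos_divide_le_eq)
    qed
  qed
qed

text \<open>A level halfway between \<open>c\<close> and \<open>rate\<close> leaves room for the
  loss \<open>2 * ln (n + 1) / n\<close>. The premise of positivity is there because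
  \<open>ln\<close> at 0 does not stand for an infinite length.\<close>

lemma code_lower_bound:
  assumes nonneg: "\<And>n w. 0 \<le> F n w" and sub: "\<And>n. word_sum n (\<lambda>w. ennreal (F n w)) \<le> 1"
    and fin: "block_entropy 1 < \<infinity>" and c: "c < rate"
  shows "AE \<omega> in M. eventually (\<lambda>n. F n (word n \<omega>) > 0 \<longrightarrow> c \<le> - ln (F n (word n \<omega>)) / real n) sequentially"
proof -
  define c' where "c' = (c + rate) / 2"
  have c': "c < c'" "c' < rate" using c by (auto simp: c'_def)
  have "AE \<omega> in M. eventually (\<lambda>n. real n * c' \<le> - ln (word_prob n (word n \<omega>))) sequentially"
  \<comment> \<open>\<open>information_lower_bound\<close> covers nonnegative levels, where
    \<open>ennreal\<close> is faithful; below 0 the claim only says that probabilities are at most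
    1.\<close>
  proof (cases "c' \<ge> 0")
    case True
    have "AE \<omega> in M. \<forall>n. word_prob n (word n \<omega>) > 0"
      by (subst AE_all_countable) (auto intro: word_prob_pos)
    with information_lower_bound[OF fin c'(2) True] show ?thesis
    proof eventually_elim
      case (elim \<omega>)
      from elim(1) show ?case
      proof eventually_elim
        case n: (elim n)
        then have "ennreal (real n * c') < ennreal (- ln (word_prob n (word n \<omega>)))"
          using elim(2) by (simp add: nlog_pos)
        then show ?case using True by (simp add: ennreal_less_iff)
      qed
    qed
  next
    case False
    have "AE \<omega> in M. \<forall>n. word_prob n (word n \<omega>) > 0"
      by (subst AE_all_countable) (auto intro: word_prob_pos)
    then show ?thesis
    proof eventually_elim
      case (elim \<omega>)
      have "real n * c' \<le> 0" for n using False by (simp add: mult_nonneg_nonpos)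
      moreover have "ln (word_prob n (word n \<omega>)) \<le> 0" for n
        using elim by simp
      ultimately show ?case by (intro always_eventually allI) (smt (verit))
    qed
  qed
  moreover note eventually_le_word_prob[of F, OF nonneg sub]
  moreover have "AE \<omega> in M. \<forall>n. word_prob n (word n \<omega>) > 0"
    by (subst AE_all_countable) (auto intro: word_prob_pos)
  ultimately show ?thesis
  proof eventually_elim
    case (elim \<omega>)
    have "(\<lambda>n. 2 * ln (real n + 1) / real n) \<longlonglongrightarrow> 0" by real_asymp
    then have "eventually (\<lambda>n. 2 * ln (real n + 1) / real n < c' - c) sequentially"
      using c' by (intro order_tendstoD) auto
    with elim(1,2) eventually_gt_at_top[of 0] show ?case
    proof eventually_elim
      case n: (elim n)
      show ?case
      proof
        let ?F = "F n (word n \<omega>)" and ?p = "word_prob n (word n \<omega>)"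
        assume "?F > 0"
        then have "ln ?F \<le> ln ((real n + 1)\<^sup>2 * ?p)" using n(2) by simp
        also have "\<dots> = 2 * ln (real n + 1) + ln ?p"
          using elim(3)[rule_format, of n] by (simp add: ln_mult ln_realpow)
        finally have "ln ?F \<le> 2 * ln (real n + 1) - real n * c'" using n(1) by simp
        moreover have "2 * ln (real n + 1) < (c' - c) * real n" using n by (simp add: divide_less_eq)
        ultimately have "real n * c \<le> - ln ?F" by (simp add: algebra_simps)
        then show "c \<le> - ln ?F / real n" using n by (simp add: field_simps)
      qed
    qed
  qed
qed

end

section \<open>From abstract sources to processes on two-sided sequences\<close>

context stationary_source
begin

lemma entropy_rate_eq_rate:
  assumes fin: "block_entropy 1 < \<infinity>"
    and Q: "\<And>n. (\<integral>\<^sup>+\<omega>. nlog (block_prob Q n \<omega>) \<partial>Q) = block_entropy n"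
  shows "entropy_rate Q = ereal rate"
proof -
  have "enn2ereal (block_entropy n) / ereal (real n) = ereal (enn2real (block_entropy n) / real n)" if "n > 0" for n
  proof -
    have "enn2ereal (block_entropy n) = ereal (enn2real (block_entropy n))"
      using block_entropy_finite[OF fin, of n] by (cases "block_entropy n") (auto simp: enn2ereal_ennreal)
    then show ?thesis using that by simp
  qed
  then have "eventually (\<lambda>n. ereal (enn2real (block_entropy n) / real n) = enn2ereal (block_entropy n) / ereal (real n)) sequentially"
    by (intro eventually_mono[OF eventually_gt_at_top[of 0]]) simp
  then have "(\<lambda>n. enn2ereal (block_entropy n) / ereal (real n)) \<longlonglongrightarrow> ereal rate"
    using rate_LIMSEQ[OF fin] by (subst tendsto_cong[symmetric]) auto
  then show ?thesis
    using Q by (simp add: entropy_rate_def nlog_def limI)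
qed

end

lemma coord_measurable:
  assumes "sets Q = sets (seqM S)"
  shows "(\<lambda>\<eta>. \<eta> k) \<in> measurable Q (count_space S)"
  using assms unfolding seqM_def by (subst measurable_cong_sets[OF _ refl]) auto

lemma space_seqM: "space (seqM S) = {\<eta>. \<forall>k. \<eta> k \<in> S}"
  by (auto simp: seqM_def space_PiM)

lemma measurable_seqM:
  assumes "sets Q = sets (seqM S)" "\<And>k. (\<lambda>\<eta>. f \<eta> k) \<in> measurable M (count_space S)"
  shows "f \<in> measurable M Q"
proof -
  have "(\<lambda>\<eta> k. f \<eta> k) \<in> measurable M (PiM UNIV (\<lambda>_. count_space S))"
    using assms measurable_space[OF assms(2)] by (intro measurable_PiM_single') (auto simp: PiE_UNIV_domain)
  then show ?thesis
    using assms(1) by (subst measurable_cong_sets[OF refl, of Q "seqM S"]) (auto simp: seqM_def)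
qed

text \<open>A source needs letters of a countable type, which cells of type \<open>'a set\<close>
  need not be; \<open>c\<close> recodes them. Reading coordinate 1 makes words agree with
  x_{1:n}.\<close>

lemma ergodic_source_coordinates:
  fixes c :: "'b \<Rightarrow> 'c::countable"
  assumes "stationary_ergodic S Q"
  shows "ergodic_source Q shift (\<lambda>\<eta>. c (\<eta> 1))"
proof -
  from assms have Q: "prob_space Q" "sets Q = sets (seqM S)" "distr Q (seqM S) shift = Q"
    "\<And>A. A \<in> sets Q \<Longrightarrow> shift -` A \<inter> space Q = A \<Longrightarrow> measure Q A = 0 \<or> measure Q A = 1"
    by (auto simp: stationary_ergodic_def)
  interpret prob_space Q by (rule Q)
  have "shift \<in> measurable Q Q"
    using coord_measurable[OF Q(2)] by (intro measurable_seqM[OF Q(2)]) (simp add: shift_def)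
  moreover have "distr Q Q shift = Q"
    by (subst (2) Q(3)[symmetric]) (rule distr_cong[OF refl Q(2) refl])
  moreover have "(\<lambda>\<eta>. c (\<eta> 1)) \<in> measurable Q (count_space UNIV)"
    by (rule measurable_compose[OF coord_measurable[OF Q(2)]]) simp
  ultimately show ?thesis
    using Q(4) by unfold_locales auto
qed

lemma word_coordinates:
  assumes "stationary_source Q shift (\<lambda>\<eta>. c (\<eta> 1) :: 'c::countable)"
  shows "stationary_source.word shift (\<lambda>\<eta>. c (\<eta> 1)) n \<eta> = map (\<lambda>i. c (\<eta> (1 + int i))) [0..<n]"
proof -
  interpret stationary_source Q shift "\<lambda>\<eta>. c (\<eta> 1)" by fact
  show ?thesis
    by (induction n arbitrary: \<eta>) (simp_all add: map_upt_Suc shift_def add.commute del: upt_Suc)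
qed

lemma block_index: "(\<forall>i\<in>{1..int n}. Pr i) \<longleftrightarrow> (\<forall>i<n. Pr (1 + int i))"
proof safe
  fix i assume *: "\<forall>i<n. Pr (1 + int i)" "i \<in> {1..int n}"
  then have "Pr (1 + int (nat (i - 1)))" by (intro *(1)[rule_format]) auto
  with * show "Pr i" by simp
qed auto

lemma block_prod: "(\<Prod>i\<in>{1..int n}. g i) = (\<Prod>i<n. g (1 + int i))" 
  and block_sum: "(\<Sum>i\<in>{1..int n}. h i) = (\<Sum>i<n. h (1 + int i))"
  by (rule prod.reindex_bij_witness[of _ "\<lambda>i. 1 + int i" "\<lambda>i. nat (i - 1)"]; auto)
     (rule sum.reindex_bij_witness[of _ "\<lambda>i. 1 + int i" "\<lambda>i. nat (i - 1)"]; auto)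

lemma block_prob_eq_word_prob:
  assumes Q: "stationary_ergodic S Q" and inj: "inj_on (c :: 'b \<Rightarrow> 'c::countable) S" and \<eta>: "\<eta> \<in> space Q"
  shows "block_prob Q n \<eta> = stationary_source.word_prob Q shift (\<lambda>\<eta>. c (\<eta> 1)) n
           (stationary_source.word shift (\<lambda>\<eta>. c (\<eta> 1)) n \<eta>)"
proof -
  interpret ergodic_source Q shift "\<lambda>\<eta>. c (\<eta> 1)" by (rule ergodic_source_coordinates[OF Q])
  have sp: "\<xi> \<in> space Q \<Longrightarrow> \<xi> k \<in> S" for \<xi> k
    using Q sets_eq_imp_space_eq[of Q "seqM S"] by (auto simp: stationary_ergodic_def space_seqM)
  have "(\<forall>i\<in>{1..int n}. \<xi> i = \<eta> i) \<longleftrightarrow> word n \<xi> = word n \<eta>" if "\<xi> \<in> space Q" for \<xi>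
    unfolding word_coordinates[OF stationary_source_axioms] block_index
    using sp[OF that] sp[OF \<eta>] inj by (auto simp: inj_on_eq_iff)
  then show ?thesis
    unfolding block_prob_def word_prob_def by (intro arg_cong[where f=prob]) auto
qed

lemma entropy_rate_eq:
  assumes Q: "stationary_ergodic S Q" and inj: "inj_on (c :: 'b \<Rightarrow> 'c::countable) S"
    and fin: "stationary_source.block_entropy Q shift (\<lambda>\<eta>. c (\<eta> 1)) 1 < \<infinity>"
  shows "entropy_rate Q = ereal (stationary_source.rate Q shift (\<lambda>\<eta>. c (\<eta> 1)))"
proof -
  interpret ergodic_source Q shift "\<lambda>\<eta>. c (\<eta> 1)" by (rule ergodic_source_coordinates[OF Q])
  show ?thesis
    using fin by (intro entropy_rate_eq_rate)
      (auto simp: block_entropy_def block_prob_eq_word_prob[OF Q inj] intro!: nn_integral_cong)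
qed

section \<open>Codes for words from measures on sequences of cells\<close>

lemma word_sum_kernel:
  assumes "\<And>A. (\<integral>\<^sup>+x. k A x \<partial>count_space UNIV) \<le> 1"
  shows "word_sum n (\<lambda>w. \<Prod>i<n. k (a i) (w ! i)) \<le> 1"
proof (induction n arbitrary: a)
  case (Suc n)
  have "word_sum (Suc n) (\<lambda>w. \<Prod>i<Suc n. k (a i) (w ! i))
      = (\<integral>\<^sup>+x. k (a 0) x * word_sum n (\<lambda>w. \<Prod>i<n. k (a (Suc i)) (w ! i)) \<partial>count_space UNIV)"
    by (simp add: prod.lessThan_Suc_shift word_sum_cmult del: prod.lessThan_Suc)
  also have "\<dots> \<le> (\<integral>\<^sup>+x. k (a 0) x * 1 \<partial>count_space UNIV)"
    by (intro nn_integral_mono mult_left_mono Suc) simp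
  also have "\<dots> \<le> 1" using assms by simp
  finally show ?case .
qed simp

text \<open>The probability of a word whose cells are drawn from \<open>R\<close> and whose letters
  are then drawn independently from \<mu> conditioned on their cells. It equals NPD^l times the
  product of the masses \<mu>(x_i). Lists are indexed from 0, the process from 1.\<close>

definition cell_code :: "'a pmf \<Rightarrow> ('a \<Rightarrow> 'a set) \<Rightarrow> (int \<Rightarrow> 'a set) measure \<Rightarrow> nat \<Rightarrow> 'a list \<Rightarrow> real" where
  "cell_code \<mu> cl R n w = measure R {\<eta> \<in> space R. \<forall>i<n. \<eta> (1 + int i) = cl (w ! i)}
     * (\<Prod>i<n. pmf \<mu> (w ! i) / measure_pmf.prob \<mu> (cl (w ! i)))"

context
  fixes \<mu> :: "'a::countable pmf" and cl :: "'a \<Rightarrow> 'a set" and R :: "(int \<Rightarrow> 'a set) measure"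
  assumes cl_mem: "\<And>x. x \<in> cl x"
    and R_prob: "prob_space R" and R_sets: "sets R = sets (seqM (range cl))"
begin

lemma pmf_le_prob_cell: "pmf \<mu> x \<le> measure_pmf.prob \<mu> (cl x)"
  unfolding measure_pmf_single[symmetric] by (intro measure_pmf.finite_measure_mono) (auto simp: cl_mem)

lemma cell_code_nonneg: "0 \<le> cell_code \<mu> cl R n w"
  by (auto simp: cell_code_def intro!: mult_nonneg_nonneg prod_nonneg)

lemma cell_code_le_1: "cell_code \<mu> cl R n w \<le> 1"
proof -
  interpret prob_space R by (rule R_prob)
  have "pmf \<mu> x / measure_pmf.prob \<mu> (cl x) \<le> 1" for x
    using pmf_le_prob_cell[of x] by (auto simp: divide_le_eq_1 measure_nonneg less_le)
  then show ?thesis unfolding cell_code_def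
    by (intro mult_le_one prod_le_1 prod_nonneg) auto
qed

lemma cell_event_sets: "{\<eta> \<in> space R. \<forall>i<n. \<eta> (1 + int i) = cl (w ! i)} \<in> sets R"
proof -
  have [measurable]: "(\<lambda>\<eta>. \<eta> k) \<in> measurable R (count_space (range cl))" for k
    by (rule coord_measurable[OF R_sets])
  have "{\<eta> \<in> space R. \<eta> k = cl x} \<in> sets R" for k x
  proof -
    have "(\<lambda>\<eta>. \<eta> k) -` {cl x} \<inter> space R \<in> sets R"
      by (rule measurable_sets[of _ _ "count_space (range cl)"]) auto
    then show ?thesis by (simp add: vimage_def Int_def conj_commute)
  qed
  then have "{\<eta> \<in> space R. \<forall>i\<in>{..<n}. \<eta> (1 + int i) = cl (w ! i)} \<in> sets R"
    by (intro sets.sets_Collect_finite_All) auto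
  then show ?thesis by simp
qed

text \<open>Given the cells \<eta>, the word has a product of kernels \<open>k\<close>, each of mass
  at most 1, as its conditional weight; Tonelli moves the sum over words inside the integral over
  \<eta>.\<close>

lemma word_sum_cell_code: "word_sum n (\<lambda>w. ennreal (cell_code \<mu> cl R n w)) \<le> 1"
proof -
  interpret prob_space R by (rule R_prob)
  define q where "q x = pmf \<mu> x / measure_pmf.prob \<mu> (cl x)" for x
  have q0: "q x \<ge> 0" for x by (simp add: q_def)
  define k where "k A x = ennreal (q x) * indicator {x. cl x = A} x" for A x
  have k: "(\<integral>\<^sup>+x. k A x \<partial>count_space UNIV) \<le> 1" for A
  proof -
    have "(\<integral>\<^sup>+x. k A x \<partial>count_space UNIV)
        = (\<integral>\<^sup>+x. ennreal (1 / measure_pmf.prob \<mu> A) * (ennreal (pmf \<mu> x) * indicator {x. cl x = A} x) \<partial>count_space UNIV)"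
      by (intro nn_integral_cong) (auto simp: k_def q_def indicator_def simp flip: ennreal_mult)
    also have "\<dots> = ennreal (1 / measure_pmf.prob \<mu> A) * emeasure (measure_pmf \<mu>) {x. cl x = A}"
      by (simp add: nn_integral_cmult nn_integral_pmf flip: nn_integral_count_space_indicator)
    also have "\<dots> \<le> ennreal (1 / measure_pmf.prob \<mu> A) * emeasure (measure_pmf \<mu>) A"
      using cl_mem by (intro mult_left_mono emeasure_mono) auto
    \<comment> \<open>If \<open>A\<close> has \<mu>-mass 0, the quotient is 0 by convention.\<close>
    also have "\<dots> \<le> 1"
      by (auto simp: measure_pmf.emeasure_eq_measure simp flip: ennreal_mult)
    finally show ?thesis .
  qed
  have "ennreal (cell_code \<mu> cl R n w) = (\<integral>\<^sup>+\<eta>. (\<Prod>i<n. k (\<eta> (1 + int i)) (w ! i)) \<partial>R)"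
    and meas: "(\<lambda>\<eta>. \<Prod>i<n. k (\<eta> (1 + int i)) (w ! i)) \<in> borel_measurable R" for w
  proof -
    let ?E = "{\<eta> \<in> space R. \<forall>i<n. \<eta> (1 + int i) = cl (w ! i)}"
    have eq: "(\<Prod>i<n. k (\<eta> (1 + int i)) (w ! i)) = ennreal (\<Prod>i<n. q (w ! i)) * indicator ?E \<eta>"
      if sp: "\<eta> \<in> space R" for \<eta>
    proof (cases "\<eta> \<in> ?E")
      case True
      then show ?thesis using q0 by (simp add: k_def prod_ennreal)
    next
      case False
      then obtain i where "i < n" "\<eta> (1 + int i) \<noteq> cl (w ! i)" using sp False by auto
      then have "(\<Prod>i<n. k (\<eta> (1 + int i)) (w ! i)) = 0"
        by (intro prod_zero bexI[of _ i]) (auto simp: k_def)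
      then show ?thesis using False by simp
    qed
    have "(\<lambda>\<eta>. ennreal (\<Prod>i<n. q (w ! i)) * indicator ?E \<eta>) \<in> borel_measurable R"
      by (intro borel_measurable_times_ennreal borel_measurable_const borel_measurable_indicator cell_event_sets)
    moreover have "(\<lambda>\<eta>. \<Prod>i<n. k (\<eta> (1 + int i)) (w ! i)) \<in> borel_measurable R
      \<longleftrightarrow> (\<lambda>\<eta>. ennreal (\<Prod>i<n. q (w ! i)) * indicator ?E \<eta>) \<in> borel_measurable R"
      by (rule measurable_cong) (rule eq)
    ultimately show "(\<lambda>\<eta>. \<Prod>i<n. k (\<eta> (1 + int i)) (w ! i)) \<in> borel_measurable R"
      by (rule iffD2[rotated])
    have "(\<integral>\<^sup>+\<eta>. (\<Prod>i<n. k (\<eta> (1 + int i)) (w ! i)) \<partial>R) = (\<integral>\<^sup>+\<eta>. ennreal (\<Prod>i<n. q (w ! i)) * indicator ?E \<eta> \<partial>R)"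
      by (intro nn_integral_cong eq)
    also have "\<dots> = ennreal (\<Prod>i<n. q (w ! i)) * emeasure R ?E"
      using cell_event_sets[of n w] by (rule nn_integral_cmult_indicator)
    finally show "ennreal (cell_code \<mu> cl R n w) = (\<integral>\<^sup>+\<eta>. (\<Prod>i<n. k (\<eta> (1 + int i)) (w ! i)) \<partial>R)"
      by (simp add: cell_code_def q_def emeasure_eq_measure mult.commute prod_nonneg ennreal_mult)
  qed
  then have "word_sum n (\<lambda>w. ennreal (cell_code \<mu> cl R n w)) = (\<integral>\<^sup>+\<eta>. word_sum n (\<lambda>w. \<Prod>i<n. k (\<eta> (1 + int i)) (w ! i)) \<partial>R)"
    by (simp add: word_sum_nn_integral(1))
  also have "\<dots> \<le> (\<integral>\<^sup>+\<eta>. 1 \<partial>R)"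
    by (intro nn_integral_mono word_sum_kernel k)
  finally show ?thesis by (simp add: emeasure_space_1)
qed

end

definition NPD_code :: "(nat \<Rightarrow> 'a \<Rightarrow> 'a set) \<Rightarrow> (nat \<Rightarrow> (int \<Rightarrow> 'a set) measure) \<Rightarrow> 'a pmf
    \<Rightarrow> nat \<Rightarrow> 'a list \<Rightarrow> real" where
  "NPD_code cell R \<mu> n w = (\<Sum>l. npd_weight l * cell_code \<mu> (cell l) (R l) n w)"

context
  fixes \<mu> :: "'a::countable pmf" and cell :: "nat \<Rightarrow> 'a \<Rightarrow> 'a set" and R :: "nat \<Rightarrow> (int \<Rightarrow> 'a set) measure"
  assumes cell_mem: "\<And>l x. x \<in> cell l x"
    and R_prob: "\<And>l. prob_space (R l)" and R_sets: "\<And>l. sets (R l) = sets (seqM (range (cell l)))"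
begin

lemma summable_NPD_code: "summable (\<lambda>l. npd_weight l * cell_code \<mu> (cell l) (R l) n w)"
proof (rule summable_comparison_test')
  show "summable npd_weight" using npd_weight_sums by (simp add: sums_iff)
  show "norm (npd_weight l * cell_code \<mu> (cell l) (R l) n w) \<le> npd_weight l" for l
    using cell_code_nonneg[of "cell l" "R l" \<mu> n w] cell_code_le_1[of "cell l" "R l" \<mu> n w] npd_weight_pos[of l]
    by (simp add: cell_mem R_prob R_sets abs_mult mult_left_le)
qed

lemma NPD_code_nonneg: "0 \<le> NPD_code cell R \<mu> n w"
  unfolding NPD_code_def
  by (intro suminf_nonneg summable_NPD_code mult_nonneg_nonneg less_imp_le[OF npd_weight_pos] cell_code_nonneg cell_mem R_prob R_sets)

lemma NPD_code_ge: "npd_weight l * cell_code \<mu> (cell l) (R l) n w \<le> NPD_code cell R \<mu> n w"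
proof -
  have "(\<Sum>l\<in>{l}. npd_weight l * cell_code \<mu> (cell l) (R l) n w) \<le> NPD_code cell R \<mu> n w"
    unfolding NPD_code_def
    by (intro sum_le_suminf summable_NPD_code mult_nonneg_nonneg less_imp_le[OF npd_weight_pos] cell_code_nonneg cell_mem R_prob R_sets) simp
  then show ?thesis by simp
qed

lemma word_sum_NPD_code: "word_sum n (\<lambda>w. ennreal (NPD_code cell R \<mu> n w)) \<le> 1"
proof -
  have nn: "npd_weight l * cell_code \<mu> (cell l) (R l) n w \<ge> 0" for l w
    by (intro mult_nonneg_nonneg less_imp_le[OF npd_weight_pos] cell_code_nonneg cell_mem R_prob R_sets)
  have "ennreal (NPD_code cell R \<mu> n w) = (\<Sum>l. ennreal (npd_weight l) * ennreal (cell_code \<mu> (cell l) (R l) n w))" for w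
    unfolding NPD_code_def
    by (subst suminf_ennreal2[symmetric, OF nn summable_NPD_code])
       (simp add: ennreal_mult less_imp_le[OF npd_weight_pos] cell_code_nonneg cell_mem R_prob R_sets)
  then have "word_sum n (\<lambda>w. ennreal (NPD_code cell R \<mu> n w))
      = (\<Sum>l. ennreal (npd_weight l) * word_sum n (\<lambda>w. ennreal (cell_code \<mu> (cell l) (R l) n w)))"
    by (simp add: word_sum_suminf word_sum_cmult)
  also have "\<dots> \<le> (\<Sum>l. ennreal (npd_weight l) * 1)"
    by (intro suminf_le allI mult_left_mono word_sum_cell_code cell_mem R_prob R_sets) auto
  also have "\<dots> = ennreal (\<Sum>l. npd_weight l)"
    using npd_weight_sums by (simp add: suminf_ennreal2 less_imp_le[OF npd_weight_pos] sums_iff)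
  also have "\<dots> = 1" using npd_weight_sums by (simp add: sums_iff)
  finally show ?thesis .
qed

lemma NPD_eq_NPD_code:
  assumes mu_pos: "\<And>x. pmf \<mu> x > 0" and w: "\<And>i. i < n \<Longrightarrow> w ! i = \<omega> (1 + int i)"
  shows "NPD cell R \<mu> n \<omega> = NPD_code cell R \<mu> n w / (\<Prod>i<n. pmf \<mu> (\<omega> (1 + int i)))"
proof -
  have "(\<Prod>i<n. pmf \<mu> (\<omega> (1 + int i))) > 0" by (intro prod_pos) (simp add: mu_pos)
  then have "NPD_l cell R \<mu> l n \<omega> = cell_code \<mu> (cell l) (R l) n w / (\<Prod>i<n. pmf \<mu> (\<omega> (1 + int i)))" for l
    using w by (simp add: NPD_l_def cell_code_def cell_mem R_prob R_sets block_index block_prod prod_dividef less_imp_neq[OF mu_pos, symmetric] cong: conj_cong)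
  then show ?thesis
    unfolding NPD_def NPD_code_def by (simp add: suminf_divide[OF summable_NPD_code])
qed

end

section \<open>Quantization\<close>

text \<open>A coordinatewise map commutes with the shift, so invariance of the law is inherited and
  invariant events pull back to invariant events.\<close>

lemma stationary_ergodic_quantized:
  assumes P: "stationary_ergodic UNIV P"
  shows "stationary_ergodic (range f) (distr P (seqM (range f)) (\<lambda>\<omega> k. f (\<omega> k)))"
    and "(\<lambda>\<omega> k. f (\<omega> k)) \<in> measurable P (seqM (range f))"
proof -
  let ?\<pi> = "\<lambda>\<omega> k. f (\<omega> (k::int))" and ?N = "seqM (range f)"
  from P have P': "prob_space P" "sets P = sets (seqM UNIV)" "distr P (seqM UNIV) shift = P"
    "\<And>A. A \<in> sets P \<Longrightarrow> shift -` A \<inter> space P = A \<Longrightarrow> measure P A = 0 \<or> measure P A = 1"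
    by (auto simp: stationary_ergodic_def)
  interpret prob_space P by (rule P')
  have spP: "space P = UNIV" using sets_eq_imp_space_eq[OF P'(2)] by (simp add: space_seqM)
  show \<pi> [measurable]: "?\<pi> \<in> measurable P ?N"
    by (intro measurable_seqM[OF refl] measurable_compose[OF coord_measurable[OF P'(2)]]) simp
  have sP: "shift \<in> measurable P P" 
    using coord_measurable[OF P'(2)] by (intro measurable_seqM[OF P'(2)]) (simp add: shift_def)
  have sN: "shift \<in> measurable ?N ?N" 
    using coord_measurable[OF refl] by (intro measurable_seqM[OF refl]) (simp add: shift_def)
  have dP: "distr P P shift = P"
    by (subst (2) P'(3)[symmetric]) (rule distr_cong[OF refl P'(2) refl])
  have comm: "shift \<circ> ?\<pi> = ?\<pi> \<circ> shift" by (simp add: fun_eq_iff shift_def)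
  define Q where "Q = distr P ?N ?\<pi>"
  have "distr Q ?N shift = distr P ?N (shift \<circ> ?\<pi>)"
    unfolding Q_def by (rule distr_distr[OF sN \<pi>])
  also have "\<dots> = distr (distr P P shift) ?N ?\<pi>"
    unfolding comm by (rule distr_distr[OF \<pi> sP, symmetric])
  finally have "distr Q ?N shift = Q" by (simp add: dP Q_def)
  moreover have "prob_space Q" unfolding Q_def by (rule prob_space_distr[OF \<pi>])
  moreover have "measure Q A = 0 \<or> measure Q A = 1" if A: "A \<in> sets Q" "shift -` A \<inter> space Q = A" for A
  proof -
    have A': "?\<pi> -` A \<in> sets P" using measurable_sets[OF \<pi>, of A] A by (simp add: Q_def spP)
    have "shift (?\<pi> \<omega>) \<in> A \<longleftrightarrow> ?\<pi> \<omega> \<in> A" for \<omega>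
      using A(2) by (auto simp: Q_def space_seqM)
    then have "shift -` (?\<pi> -` A) \<inter> space P = ?\<pi> -` A"
      by (auto simp: spP shift_def)
    moreover have "measure Q A = measure P (?\<pi> -` A)"
      using A by (simp add: Q_def measure_distr[OF \<pi>] spP)
    ultimately show ?thesis using P'(4)[OF A'] by simp
  qed
  ultimately show "stationary_ergodic (range f) (distr P ?N ?\<pi>)"
    unfolding Q_def stationary_ergodic_def by simp
qed

text \<open>The self-information under \<mu> of a letter given its cell: the price per letter of
  refining a code for cells to one for letters.\<close>

definition cell_loss :: "'a pmf \<Rightarrow> ('a \<Rightarrow> 'a set) \<Rightarrow> (int \<Rightarrow> 'a) \<Rightarrow> real" where
  "cell_loss \<mu> cl \<omega> = ln (measure_pmf.prob \<mu> (cl (\<omega> 1))) - ln (pmf \<mu> (\<omega> 1))"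

context
  fixes P :: "(int \<Rightarrow> 'a::countable) measure" and \<mu> :: "'a pmf"
  assumes P_se: "stationary_ergodic UNIV P" and mu_pos: "\<And>x. pmf \<mu> x > 0"
    and integrable_log: "integrable P (\<lambda>\<omega>. ln (pmf \<mu> (\<omega> 1)))"
begin

interpretation ergodic_source P shift "\<lambda>\<omega>. \<omega> 1"
  using ergodic_source_coordinates[OF P_se, of "\<lambda>x. x"] .

lemma word_nth: "i < n \<Longrightarrow> word n \<omega> ! i = \<omega> (1 + int i)"
  using word_coordinates[of P "\<lambda>x. x" n \<omega>] stationary_source_axioms by simp

lemma shift_funpow: "(shift ^^ n) \<omega> = (\<lambda>k. \<omega> (k + int n))"
  by (induction n arbitrary: \<omega>) (simp_all add: shift_def fun_eq_iff algebra_simps)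

text \<open>Gibbs' inequality with \<mu> itself as the code for one letter.\<close>

lemma entropy_finite: "block_entropy 1 < \<infinity>"
proof -
  have "word_sum 1 (\<lambda>w. ennreal (pmf \<mu> (hd w))) = 1"
    by (simp add: nn_integral_pmf measure_pmf.emeasure_space_1[simplified])
  then have "block_entropy 1 \<le> (\<integral>\<^sup>+\<omega>. nlog (pmf \<mu> (hd (word 1 \<omega>))) \<partial>P)"
    by (intro gibbs) auto
  also have "\<dots> = (\<integral>\<^sup>+\<omega>. ennreal (norm (ln (pmf \<mu> (\<omega> 1)))) \<partial>P)"
    by (intro nn_integral_cong) (simp add: nlog_pos mu_pos pmf_le_1 abs_of_nonpos)
  also have "\<dots> < \<infinity>" using integrable_log by (simp add: integrable_iff_bounded)
  finally show ?thesis .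
qed

lemma entropy_rate_P: "entropy_rate P = ereal rate"
  using entropy_rate_eq[OF P_se, of "\<lambda>x. x"] entropy_finite by simp

context
  fixes cl :: "'a \<Rightarrow> 'a set" and R :: "(int \<Rightarrow> 'a set) measure"
  assumes cl_mem: "\<And>x. x \<in> cl x" and cl_part: "\<And>x y. y \<in> cl x \<Longrightarrow> cl y = cl x"
    and R_prob: "prob_space R" and R_sets: "sets R = sets (seqM (range cl))"
    and R_univ: "universal (range cl) R"
begin

text \<open>The majorant does not involve the partition, so a single integrable function dominates
  the losses of all levels.\<close>

lemma cell_loss_bounds: "0 \<le> cell_loss \<mu> cl \<omega>" "cell_loss \<mu> cl \<omega> \<le> \<bar>ln (pmf \<mu> (\<omega> 1))\<bar>"
proof -
  let ?p = "pmf \<mu> (\<omega> 1)" and ?q = "measure_pmf.prob \<mu> (cl (\<omega> 1))"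
  have le: "?p \<le> ?q" by (rule pmf_le_prob_cell[OF cl_mem R_prob R_sets])
  then have "?q > 0" using mu_pos[of "\<omega> 1"] by linarith
  then have "ln ?p \<le> ln ?q" "ln ?q \<le> 0"
    using le mu_pos[of "\<omega> 1"] by simp_all
  then show "0 \<le> cell_loss \<mu> cl \<omega>" "cell_loss \<mu> cl \<omega> \<le> \<bar>ln (pmf \<mu> (\<omega> 1))\<bar>"
    by (auto simp: cell_loss_def)
qed

lemma cell_loss_meas [measurable]: "cell_loss \<mu> cl \<in> borel_measurable P"
proof -
  have "(\<lambda>\<omega>. (\<lambda>x. ln (measure_pmf.prob \<mu> (cl x)) - ln (pmf \<mu> x)) (\<omega> 1)) \<in> borel_measurable P"
    by (rule measurable_compose[OF X_meas]) simp
  then show ?thesis by (simp add: cell_loss_def[abs_def])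
qed

lemma integrable_cell_loss: "integrable P (cell_loss \<mu> cl)"
  using cell_loss_bounds by (intro Bochner_Integration.integrable_bound[OF integrable_log]) auto

text \<open>Data processing at the level of cylinders: the cylinder of a quantized word contains
  that of the word, so self-information drops pointwise and the block entropies compare for every
  \<open>n\<close>.\<close>

lemma cell_entropy_rate:
  obtains h where "entropy_rate (distr P (seqM (range cl)) (\<lambda>\<omega> k. cl (\<omega> k))) = ereal h" "h \<le> rate"
proof -
  let ?\<pi> = "\<lambda>\<omega> k. cl (\<omega> (k::int))"
  define Q where "Q = distr P (seqM (range cl)) ?\<pi>"
  \<comment> \<open>Representatives recode cells by letters of the countable type; since
    \<open>cl (rep A) = A\<close> for every cell, this is injective on cells.\<close>
  define rep where "rep A = (SOME x. x \<in> A)" for A :: "'a set"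
  have Q: "stationary_ergodic (range cl) Q"
    and \<pi> [measurable]: "?\<pi> \<in> measurable P (seqM (range cl))"
    unfolding Q_def by (rule stationary_ergodic_quantized[OF P_se])+
  have \<pi>Q [measurable]: "?\<pi> \<in> measurable P Q" by (simp add: Q_def)
  have dQ: "distr P Q ?\<pi> = Q"
    by (subst (2) Q_def) (rule distr_cong[OF refl _ refl], simp add: Q_def)
  have "rep (cl x) \<in> cl x" for x unfolding rep_def by (rule someI[of _ x]) (rule cl_mem)
  then have rep: "cl (rep (cl x)) = cl x" for x by (rule cl_part)
  have inj: "inj_on rep (range cl)"
  proof (rule inj_onI)
    fix A B assume AB: "A \<in> range cl" "B \<in> range cl" "rep A = rep B"
    have "cl (rep A) = A" "cl (rep B) = B" using AB(1,2) by (auto simp: rep)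
    then show "A = B" using AB(3) by metis
  qed
  interpret Q: ergodic_source Q shift "\<lambda>\<eta>. rep (\<eta> 1)" by (rule ergodic_source_coordinates[OF Q])
  have Q_word: "Q.word n (?\<pi> \<omega>) = map (\<lambda>x. rep (cl x)) (word n \<omega>)" for n \<omega>
    unfolding word_coordinates[OF Q.stationary_source_axioms] word_coordinates[OF stationary_source_axioms] by simp
  have le: "Q.block_entropy n \<le> block_entropy n" for n
  proof -
    have "Q.block_entropy n = (\<integral>\<^sup>+\<omega>. nlog (Q.word_prob n (Q.word n (?\<pi> \<omega>))) \<partial>P)"
      unfolding Q.block_entropy_def
      using nn_integral_distr[OF \<pi>Q, of "\<lambda>\<eta>. nlog (Q.word_prob n (Q.word n \<eta>))"] by (simp add: dQ)
    also have "\<dots> \<le> block_entropy n"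
      unfolding block_entropy_def
    proof (intro nn_integral_mono nlog_antimono)
      fix \<omega>
      have "Q.word_prob n (Q.word n (?\<pi> \<omega>)) = measure P (?\<pi> -` {\<eta> \<in> space Q. Q.word n \<eta> = Q.word n (?\<pi> \<omega>)} \<inter> space P)"
        unfolding Q.word_prob_def
        using measure_distr[OF \<pi>Q, of "{\<eta> \<in> space Q. Q.word n \<eta> = Q.word n (?\<pi> \<omega>)}"] by (simp add: dQ)
      also have "\<dots> \<ge> word_prob n (word n \<omega>)"
        unfolding word_prob_def using measurable_space[OF \<pi>Q]
        by (intro finite_measure_mono measurable_sets[OF \<pi>Q]) (auto simp: Q_word)
      finally show "word_prob n (word n \<omega>) \<le> Q.word_prob n (Q.word n (?\<pi> \<omega>))" .
    qed
    finally show ?thesis .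
  qed
  have fin: "Q.block_entropy 1 < \<infinity>" using le[of 1] entropy_finite by (rule le_less_trans)
  have "Q.rate \<le> rate"
    using le block_entropy_finite[OF entropy_finite]
    by (intro LIMSEQ_le[OF Q.rate_LIMSEQ[OF fin] rate_LIMSEQ[OF entropy_finite]] exI allI impI divide_right_mono enn2real_mono) auto
  then show ?thesis
    using that entropy_rate_eq[OF Q inj fin] by (simp add: Q_def)
qed

text \<open>The code length is that of the cells under \<open>R\<close>, governed by universality,
  plus a Birkhoff sum of \<open>cell_loss\<close>. One third of \<open>e\<close> goes to each of
  these limits and one to the constant \<open>K\<close> divided by \<open>n\<close>.\<close>

lemma cell_code_upper:
  assumes e: "e > 0"
  shows "AE \<omega> in P. eventually (\<lambda>n. cell_code \<mu> cl R n (word n \<omega>) > 0 \<and>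
    - ln (cell_code \<mu> cl R n (word n \<omega>)) \<le> real n * (rate + (\<integral>\<omega>. cell_loss \<mu> cl \<omega> \<partial>P) + e)) sequentially"
proof -
  let ?\<pi> = "\<lambda>\<omega> k. cl (\<omega> (k::int))"
  define L where "L = (\<integral>\<omega>. cell_loss \<mu> cl \<omega> \<partial>P)"
  obtain h where h: "entropy_rate (distr P (seqM (range cl)) ?\<pi>) = ereal h" "h \<le> rate"
    by (rule cell_entropy_rate)
  define m where "m n \<eta> = measure R {\<eta>' \<in> space R. \<forall>i\<in>{1..int n}. \<eta>' i = \<eta> i}" for n \<eta>
  have "AE \<eta> in distr P (seqM (range cl)) ?\<pi>. (\<lambda>n. neglog (m n \<eta>) / ereal (real n)) \<longlonglongrightarrow> ereal h"
    using conjunct1[OF R_univ[unfolded universal_def Let_def, THEN spec, THEN mp,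
          OF stationary_ergodic_quantized(1)[OF P_se, of cl]]]
    unfolding m_def h(1) .
  then have "AE \<omega> in P. (\<lambda>n. neglog (m n (?\<pi> \<omega>)) / ereal (real n)) \<longlonglongrightarrow> ereal h"
    by (rule AE_distrD[OF stationary_ergodic_quantized(2)[OF P_se]])
  moreover have "AE \<omega> in P. \<exists>K. \<forall>n. (\<Sum>i<n. cell_loss \<mu> cl ((shift ^^ i) \<omega>)) \<le> real n * (L + e / 3) + K"
    by (rule birkhoff_upper[OF integrable_cell_loss]) (use e in \<open>simp add: L_def\<close>)
  ultimately show ?thesis
  proof eventually_elim
    case (elim \<omega>)
    then obtain K where K: "\<And>n. (\<Sum>i<n. cell_loss \<mu> cl ((shift ^^ i) \<omega>)) \<le> real n * (L + e / 3) + K" by blast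
    have "(\<lambda>n. K / real n) \<longlonglongrightarrow> 0" by (rule lim_const_over_n)
    then have "eventually (\<lambda>n. K / real n < e / 3) sequentially" using e by (intro order_tendstoD) auto
    moreover have "eventually (\<lambda>n. neglog (m n (?\<pi> \<omega>)) / ereal (real n) < ereal (h + e / 3)) sequentially"
      using elim(1) e by (intro order_tendstoD) auto
    ultimately show ?case
      using eventually_gt_at_top[of 0]
    proof eventually_elim
      case n: (elim n)
      \<comment> \<open>\<open>neglog\<close> is infinite at 0, so the finite bound yields
        positivity as well.\<close>
      have "m n (?\<pi> \<omega>) > 0 \<and> - ln (m n (?\<pi> \<omega>)) / real n < h + e / 3"
        using n(2,3) by (auto simp: neglog_def split: if_splits)
      then have m: "m n (?\<pi> \<omega>) > 0" "- ln (m n (?\<pi> \<omega>)) < real n * (h + e / 3)"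
        using n(3) by (simp, metis pos_divide_less_eq mult.commute of_nat_0_less_iff)
      define q where "q i = pmf \<mu> (\<omega> (1 + int i)) / measure_pmf.prob \<mu> (cl (\<omega> (1 + int i)))" for i
      have pos: "measure_pmf.prob \<mu> (cl x) > 0" for x
        using pmf_le_prob_cell[OF cl_mem R_prob R_sets, of \<mu> x] mu_pos[of x] by linarith
      have q: "q i > 0" "- ln (q i) = cell_loss \<mu> cl ((shift ^^ i) \<omega>)" for i
        using pos mu_pos by (auto simp: q_def shift_funpow cell_loss_def ln_div less_imp_neq[symmetric])
      have eq: "cell_code \<mu> cl R n (word n \<omega>) = m n (?\<pi> \<omega>) * (\<Prod>i<n. q i)"
        by (simp add: cell_code_def m_def block_index word_nth q_def cong: conj_cong)
      have pos': "(\<Prod>i<n. q i) > 0" by (intro prod_pos) (simp add: q)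
      then have "- ln (cell_code \<mu> cl R n (word n \<omega>)) = - ln (m n (?\<pi> \<omega>)) + (\<Sum>i<n. - ln (q i))"
        using m(1) q(1) by (simp add: eq ln_mult ln_prod sum_negf less_imp_neq[symmetric])
      also have "\<dots> \<le> real n * (h + e / 3) + (real n * (L + e / 3) + K)"
        using m(2) K[of n] by (simp add: q(2))
      also have "\<dots> \<le> real n * (h + e / 3) + (real n * (L + e / 3) + real n * (e / 3))"
        using n(1,3) by (simp add: divide_less_eq mult.commute)
      also have "\<dots> = real n * (h + L + e)" by (simp add: algebra_simps)
      also have "\<dots> \<le> real n * (rate + L + e)" using h(2) by (intro mult_left_mono) auto
      finally show ?case using m(1) pos' by (simp add: eq L_def)
    qed
  qed
qed

end

end

text \<open>The sets that do not separate two given points form a sigma-field. Points sharing a cell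
  at every level are thus separated by no set of the generated field, which contains
  \<open>{x}\<close>.\<close>

lemma refining_cells_Inter:
  assumes mem: "\<And>l x. x \<in> cell l x" and part: "\<And>l x y. y \<in> cell l x \<Longrightarrow> cell l y = cell l x"
    and mono: "\<And>l. sigma_sets UNIV (range (cell l)) \<subseteq> sigma_sets UNIV (range (cell (Suc l)))"
    and gen: "sigma_sets UNIV (\<Union>l. sigma_sets UNIV (range (cell l))) = Pow UNIV"
  shows "decseq (\<lambda>l. cell l x)" and "(\<Inter>l. cell l x) = {x}"
proof -
  have cells: "y \<in> cell l x \<Longrightarrow> A \<in> sigma_sets UNIV (range (cell l)) \<Longrightarrow> x \<in> A \<longleftrightarrow> y \<in> A" for l x y A
  proof (rotate_tac, induction rule: sigma_sets.induct)
    case (Basic a)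
    then show ?case by (metis imageE mem part)
  qed auto
  show "decseq (\<lambda>l. cell l x)"
  proof (rule decseq_SucI, rule subsetI)
    fix l y assume "y \<in> cell (Suc l) x"
    moreover have "cell l x \<in> sigma_sets UNIV (range (cell (Suc l)))"
      using mono[of l] by (auto intro: sigma_sets.Basic)
    ultimately show "y \<in> cell l x" using cells mem by blast
  qed
  show "(\<Inter>l. cell l x) = {x}"
  proof (intro equalityI subsetI)
    fix y assume y: "y \<in> (\<Inter>l. cell l x)"
    have "A \<in> sigma_sets UNIV (\<Union>l. sigma_sets UNIV (range (cell l))) \<Longrightarrow> x \<in> A \<longleftrightarrow> y \<in> A" for A
    proof (induction rule: sigma_sets.induct)
      case (Basic a)
      then show ?case using y cells by blast
    qed auto
    from this[of "{x}"] show "y \<in> {x}" unfolding gen by simp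
  qed (use mem in auto)
qed

section \<open>The limit of the NPD code length\<close>

theorem mainTheorem9:
  fixes \<mu> :: "('a::countable) pmf"
    and P :: "(int \<Rightarrow> 'a) measure"
    and cell :: "nat \<Rightarrow> 'a \<Rightarrow> 'a set"
    and R :: "nat \<Rightarrow> (int \<Rightarrow> 'a set) measure"
  assumes alphabet_infinite: "infinite (UNIV :: 'a set)"
    and mu_pos: "\<forall>x. pmf \<mu> x > 0"
    and cell_finite: "\<forall>l. finite (range (cell l))"
    and cell_mem: "\<forall>l x. x \<in> cell l x"
    and cell_partition: "\<forall>l x y. y \<in> cell l x \<longrightarrow> cell l y = cell l x"
    and sigma_zero: "sigma_sets UNIV (range (cell 0)) = {{}, UNIV}"
    and sigma_mono: "\<forall>l. sigma_sets UNIV (range (cell l)) \<subseteq> sigma_sets UNIV (range (cell (Suc l)))"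
    and sigma_gen: "sigma_sets UNIV (\<Union>l. sigma_sets UNIV (range (cell l))) = Pow UNIV"
    and R_prob: "\<forall>l. prob_space (R l)"
    and R_sets: "\<forall>l. sets (R l) = sets (seqM (range (cell l)))"
    and R_univ: "\<forall>l. universal (range (cell l)) (R l)"
    and P_se: "stationary_ergodic UNIV P"
    and rel_entropy_finite:
      "(\<lambda>x. - measure P {\<omega> \<in> space P. \<omega> 1 = x} * ln (pmf \<mu> x)) summable_on UNIV"
  shows "AE \<omega> in P. (\<lambda>n. ereal ((- ln (NPD cell R \<mu> n \<omega>)
                                   - (\<Sum>i\<in>{1..int n}. ln (pmf \<mu> (\<omega> i)))) / real n))
                      \<longlonglongrightarrow> entropy_rate P"
proof -
  interpret ergodic_source P shift "\<lambda>\<omega>. \<omega> 1"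
    using ergodic_source_coordinates[OF P_se, of "\<lambda>x. x"] .
  have [measurable]: "(\<lambda>\<omega>. g (\<omega> 1)) \<in> borel_measurable P" for g :: "'a \<Rightarrow> real"
    by (rule measurable_compose[OF X_meas]) simp
  note assms' = mu_pos[rule_format] cell_mem[rule_format] R_prob[rule_format] R_sets[rule_format]
  have "integrable P (\<lambda>\<omega>. ln (pmf \<mu> (\<omega> 1)))"
  proof (rule integrableI_bounded)
    let ?f = "\<lambda>x. - measure P {\<omega> \<in> space P. \<omega> 1 = x} * ln (pmf \<mu> x)"
    have "(\<integral>\<^sup>+\<omega>. ennreal (norm (ln (pmf \<mu> (\<omega> 1)))) \<partial>P)
        = (\<integral>\<^sup>+x. ennreal (norm (ln (pmf \<mu> x))) * ennreal (word_prob 1 [x]) \<partial>count_space UNIV)"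
      using nn_integral_word[of "\<lambda>w. ennreal (norm (ln (pmf \<mu> (hd w))))" 1] by simp
    also have "\<dots> = (\<integral>\<^sup>+x. ennreal (norm (?f x)) \<partial>count_space UNIV)"
      by (intro nn_integral_cong) (simp add: word_prob_def abs_mult mult.commute flip: ennreal_mult)
    \<comment> \<open>Unordered summability of reals is absolute summability, so the hypothesis says
      that -ln \<mu>(X_1) has finite mean.\<close>
    also have "\<dots> < \<infinity>"
      using rel_entropy_finite[THEN summable_on_iff_abs_summable_on_real[THEN iffD1]]
      unfolding abs_summable_equivalent abs_summable_on_def
      by (simp add: integrable_iff_bounded)
    finally show "(\<integral>\<^sup>+\<omega>. ennreal (norm (ln (pmf \<mu> (\<omega> 1)))) \<partial>P) < \<infinity>" .
  qed measurable
  note loc = P_se assms'(1) this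
  note loc2 = loc assms'(2) cell_partition[rule_format] assms'(3,4) R_univ[rule_format]
  define loss where "loss l = (\<integral>\<omega>. cell_loss \<mu> (cell l) \<omega> \<partial>P)" for l
  have loss_0: "loss \<longlonglongrightarrow> 0"
  proof -
    have "(\<lambda>l. \<integral>\<omega>. cell_loss \<mu> (cell l) \<omega> \<partial>P) \<longlonglongrightarrow> (\<integral>\<omega>. 0 \<partial>P)"
    proof (rule integral_dominated_convergence[where w="\<lambda>\<omega>. \<bar>ln (pmf \<mu> (\<omega> 1))\<bar>"])
      show "AE \<omega> in P. (\<lambda>l. cell_loss \<mu> (cell l) \<omega>) \<longlonglongrightarrow> 0"
      proof (rule AE_I2)
        fix \<omega> :: "int \<Rightarrow> 'a"
        note cells = refining_cells_Inter[of cell, OF cell_mem[rule_format] cell_partition[rule_format]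
            sigma_mono[rule_format] sigma_gen]
        have "(\<lambda>l. measure_pmf.prob \<mu> (cell l (\<omega> 1))) \<longlonglongrightarrow> measure_pmf.prob \<mu> (\<Inter>l. cell l (\<omega> 1))"
          by (intro measure_pmf.finite_Lim_measure_decseq cells(1)) auto
        also have "(\<Inter>l. cell l (\<omega> 1)) = {\<omega> 1}"
          by (rule cells(2))
        finally have "(\<lambda>l. ln (measure_pmf.prob \<mu> (cell l (\<omega> 1))) - ln (pmf \<mu> (\<omega> 1))) \<longlonglongrightarrow> ln (pmf \<mu> (\<omega> 1)) - ln (pmf \<mu> (\<omega> 1))"
          using assms'(1)[of "\<omega> 1"] by (intro tendsto_intros) (auto simp: measure_pmf_single)
        then show "(\<lambda>l. cell_loss \<mu> (cell l) \<omega>) \<longlonglongrightarrow> 0"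
          by (simp add: cell_loss_def)
      qed
    qed (use loc(3) cell_loss_bounds[OF loc2] cell_loss_meas[OF loc2] in auto)
    then show ?thesis by (simp add: loss_def[abs_def])
  qed
  let ?c = "\<lambda>n \<omega>. NPD_code cell R \<mu> n (word n \<omega>)"
  have fin: "block_entropy 1 < \<infinity>" by (rule entropy_finite[OF loc])
  \<comment> \<open>Tolerances 1 / (k + 1) keep the exceptional null sets countable in
    number.\<close>
  have lower: "AE \<omega> in P. \<forall>k::nat. eventually (\<lambda>n. ?c n \<omega> > 0 \<longrightarrow> rate - 1 / Suc k \<le> - ln (?c n \<omega>) / real n) sequentially"
    unfolding AE_all_countable
    by (intro allI code_lower_bound NPD_code_nonneg word_sum_NPD_code assms' fin) simp
  have upper: "AE \<omega> in P. \<forall>k::nat. eventually (\<lambda>n. ?c n \<omega> > 0 \<and> - ln (?c n \<omega>) / real n < rate + 1 / Suc k) sequentially"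
    unfolding AE_all_countable
  proof
    fix k :: nat
    \<comment> \<open>The thirds pay for the loss of the chosen level, the error in
      \<open>cell_code_upper\<close> and the weight of the level. The level depends on
      \<open>k\<close> alone, so its weight is a constant as \<open>n\<close> grows.\<close>
    define e where "e = 1 / real (Suc k) / 3"
    have e: "e > 0" "1 / real (Suc k) = 3 * e" by (simp_all add: e_def del: of_nat_Suc)
    obtain l where l: "loss l < e"
      using order_tendstoD(2)[OF loss_0 e(1)] by (auto simp: eventually_sequentially)
    have "AE \<omega> in P. eventually (\<lambda>n. cell_code \<mu> (cell l) (R l) n (word n \<omega>) > 0 \<and>
        - ln (cell_code \<mu> (cell l) (R l) n (word n \<omega>)) \<le> real n * (rate + loss l + e)) sequentially"
      unfolding loss_def by (rule cell_code_upper[OF loc2 e(1)])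
    then show "AE \<omega> in P. eventually (\<lambda>n. ?c n \<omega> > 0 \<and> - ln (?c n \<omega>) / real n < rate + 1 / Suc k) sequentially"
    proof eventually_elim
      case (elim \<omega>)
      have "(\<lambda>n. - ln (npd_weight l) / real n) \<longlonglongrightarrow> 0" by (rule lim_const_over_n)
      then have "eventually (\<lambda>n. - ln (npd_weight l) / real n < e) sequentially"
        using e by (intro order_tendstoD) auto
      with elim eventually_gt_at_top[of 0] show ?case
      proof eventually_elim
        case n: (elim n)
        let ?d = "cell_code \<mu> (cell l) (R l) n (word n \<omega>)"
        have ge: "npd_weight l * ?d \<le> ?c n \<omega>" by (intro NPD_code_ge assms')
        have pos: "npd_weight l * ?d > 0" using n(1) npd_weight_pos[of l] by simp
        have "- ln (?c n \<omega>) \<le> - ln (npd_weight l * ?d)" using ge pos by simp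
        also have "\<dots> = - ln (npd_weight l) - ln ?d"
          using n(1) npd_weight_pos[of l] by (simp add: ln_mult)
        also have "- ln (npd_weight l) < e * real n"
          using n(2,3) by (metis pos_divide_less_eq of_nat_0_less_iff)
        also have "e * real n - ln ?d \<le> e * real n + real n * (rate + loss l + e)"
          using n(1) by simp
        also have "\<dots> \<le> real n * (rate + 3 * e)"
          using mult_left_mono[of "loss l" e "real n"] l by (simp add: algebra_simps)
        finally have "- ln (?c n \<omega>) < (rate + 3 * e) * real n"
          by (simp add: mult.commute)
        then have "- ln (?c n \<omega>) / real n < rate + 3 * e"
          using n(2) by (metis pos_divide_less_eq of_nat_0_less_iff)
        then show ?case using ge pos e(2) by simp
      qed
    qed
  qed
  from lower upper show ?thesis
  proof eventually_elim
    case (elim \<omega>)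
    have "(\<lambda>n. - ln (?c n \<omega>) / real n) \<longlonglongrightarrow> rate"
    proof (rule LIMSEQ_I)
      fix r :: real assume "r > 0"
      then obtain k where k: "1 / real (Suc k) < r" using nat_approx_posE by blast
      have "eventually (\<lambda>n. norm (- ln (?c n \<omega>) / real n - rate) < r) sequentially"
        using elim(1)[rule_format, of k] elim(2)[rule_format, of k]
        by eventually_elim (use k in \<open>simp add: abs_less_iff\<close>)
      then show "\<exists>no. \<forall>n\<ge>no. norm (- ln (?c n \<omega>) / real n - rate) < r"
        by (simp add: eventually_sequentially)
    qed
    \<comment> \<open>The upper bound, at any \<open>k\<close>, provides the positivity of the code
      that splits the logarithm of the quotient.\<close>
    moreover have "eventually (\<lambda>n. - ln (?c n \<omega>) / real n =
        (- ln (NPD cell R \<mu> n \<omega>) - (\<Sum>i\<in>{1..int n}. ln (pmf \<mu> (\<omega> i)))) / real n) sequentially"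
      using elim(2)[rule_format, of 0]
    proof eventually_elim
      case n: (elim n)
      have pos: "(\<Prod>i<n. pmf \<mu> (\<omega> (1 + int i))) > 0" by (intro prod_pos) (simp add: assms')
      have "NPD cell R \<mu> n \<omega> = ?c n \<omega> / (\<Prod>i<n. pmf \<mu> (\<omega> (1 + int i)))"
        by (intro NPD_eq_NPD_code assms' word_nth[OF loc])
      moreover have "ln (\<Prod>i<n. pmf \<mu> (\<omega> (1 + int i))) = (\<Sum>i<n. ln (pmf \<mu> (\<omega> (1 + int i))))"
        by (intro ln_prod) (simp_all add: less_imp_neq[OF assms'(1), symmetric])
      ultimately have "ln (NPD cell R \<mu> n \<omega>) = ln (?c n \<omega>) - (\<Sum>i<n. ln (pmf \<mu> (\<omega> (1 + int i))))"
        using n by (simp add: ln_div less_imp_neq[OF assms'(1), symmetric])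
      then show ?case by (simp add: block_sum)
    qed
    ultimately show ?case
      unfolding entropy_rate_P[OF loc] by (simp add: tendsto_cong)
  qed
qed

end
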